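(* Let $\kappa,\lambda$ be infinite cardinals with $\mathbf{c}\le\kappa\le\lambda\le 2^\kappa$. Then there exist $2^\lambda$ mutually non-homeomorphic pathwise connected, locally pathwise connected, almost metrizable spaces of size $\kappa$ and weight $\lambda$.
   Context: $\mathbf{c}=2^{\aleph_0}$. The size of a space is its cardinality; the weight is the least size of a basis. A space is perfectly normal if it is normal (including Hausdorff) and every closed set is a $G_\delta$-set. A space $X$ is almost metrizable if $X$ is perfectly normal and $X\setminus\{x\}$ is metrizable for some $x\in X$. *)

theory Defs
  imports "HOL-Analysis.Analysis"
begin

no_notation elt_set_eq (infix "=o" 50)
unbundle cardinal_syntax

definition base_of_topology :: "'a topology \<Rightarrow> 'a set set \<Rightarrow> bool" where
  "base_of_topology X \<B> \<longleftrightarrow>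
     (\<forall>V\<in>\<B>. openin X V) \<and> (\<forall>U. openin X U \<longrightarrow> (\<exists>\<U>\<subseteq>\<B>. U = \<Union>\<U>))"

text \<open>Cardinals are cardinal orders, compared up to \<open>=o\<close>. A least size of a base
  exists because cardinals are well-ordered; being the weight is stated as a relation,
  and \<open>has_weight_unique\<close> says that it determines the cardinal up to \<open>=o\<close>.\<close>

definition has_weight :: "'a topology \<Rightarrow> 'b rel \<Rightarrow> bool" where
  "has_weight X r \<longleftrightarrow>
     (\<exists>\<B>. base_of_topology X \<B> \<and> |\<B>| =o r) \<and>
     (\<forall>\<B>. base_of_topology X \<B> \<longrightarrow> r \<le>o |\<B>| )"

lemma has_weight_unique:
  assumes "has_weight X r" and "has_weight X s"
  shows "r =o s"
  using assms unfolding has_weight_def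
  by (meson ordIso_iff_ordLeq ordLeq_ordIso_trans)

text \<open>The library's \<open>normal_space\<close> does not include the Hausdorff axiom.\<close>

definition perfectly_normal_space :: "'a topology \<Rightarrow> bool" where
  "perfectly_normal_space X \<longleftrightarrow>
     normal_space X \<and> Hausdorff_space X \<and> (\<forall>C. closedin X C \<longrightarrow> gdelta_in X C)"

definition almost_metrizable_space :: "'a topology \<Rightarrow> bool" where
  "almost_metrizable_space X \<longleftrightarrow>
     perfectly_normal_space X \<and>
     (\<exists>x\<in>topspace X. metrizable_space (subtopology X (topspace X - {x})))"

end

theory Submission
  imports Defs "HOL-Library.Sublist"
begin

text \<open>
  The spaces coarsen the topology of a fixed metric tree at its root. Its nodes are the finite sequences
  over \<open>Field \<kappa> \<times> \<nat>\<close> whose first components strictly decrease, joined to their parents by unit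
  segments. A family \<open>J\<close> of subsets of \<open>Field \<kappa>\<close> generates a filter, and the neighbourhoods of the root
  are enlarged by whole branches: those whose first label lies in a member of the filter and
  whose copy number in \<open>\<nat>\<close> is large. Taking \<open>J\<close> inside an independent family makes the character of the root equal
  to \<open>|J|\<close>, while the copy numbers keep the root a \<open>G\<^sub>\<delta>\<close> point.

  A homeomorphism fixes the root, the only point without a countable neighbourhood base. Hence it preserves
  the tree order, since \<open>y\<close> lies between \<open>x\<close> and the root iff every connected set containing
  \<open>x\<close> and the root contains \<open>y\<close>. Induction along the well-order \<open>\<kappa>\<close> shows that it preserves labels:
  every ordinal below a label occurs at several mutually incomparable children, whereas the points
  below \<open>x\<close> carrying the label of \<open>x\<close> form a chain. So \<open>J\<close> can be read off the topology, and
  there are \<open>2\<^sup>\<lambda>\<close> choices of \<open>J\<close> with \<open>|J| = \<lambda>\<close>.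
\<close>

declare split_paired_All [simp del] split_paired_Ex [simp del]

subsection \<open>Topological preliminaries\<close>

text \<open>Disjoint closed sets are separated in the metrizable open complement of \<open>p\<close>
  and the result is repaired near \<open>p\<close>. If \<open>p\<close> lies outside
  \<open>T\<close>, take \<open>V \<subseteq> C\<close> around \<open>p\<close> with
  \<open>C\<close> missing \<open>T\<close>; then \<open>V\<close> is added on the side of
  \<open>S\<close> and \<open>C\<close> is removed on the side of \<open>T\<close>. Off
  \<open>p\<close> a closed set is G-delta by metrizability, and \<open>{p}\<close> is added back
  when necessary.\<close>

lemma perfectly_normal_if_metrizable_off_point:
  assumes T1: "t1_space X" and p: "p \<in> topspace X" and g: "gdelta_in X {p}"
    and m: "metrizable_space (subtopology X (topspace X - {p}))"
    and nb: "\<And>U. openin X U \<Longrightarrow> p \<in> U \<Longrightarrow> \<exists>V C. openin X V \<and> closedin X C \<and> p \<in> V \<and> V \<subseteq> C \<and> C \<subseteq> U"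
  shows "perfectly_normal_space X"
proof -
  let ?Y = "topspace X - {p}"
  have oY: "openin X ?Y"
    using T1 p by (simp add: t1_space_openin_delete_alt)
  have sep: "\<exists>U V. openin X U \<and> openin X V \<and> S \<subseteq> U \<and> T \<subseteq> V \<and> disjnt U V"
    if S: "closedin X S" and T: "closedin X T" and d: "disjnt S T" and pT: "p \<notin> T" for S T
  proof -
    have "openin X (topspace X - T)" "p \<in> topspace X - T"
      using T p pT by auto
    then obtain V C where VC: "openin X V" "closedin X C" "p \<in> V" "V \<subseteq> C" "C \<subseteq> topspace X - T"
      using nb by meson
    have "closedin (subtopology X ?Y) (?Y \<inter> S)" "closedin (subtopology X ?Y) (?Y \<inter> T)"
      using S T closedin_subtopology_Int_closed by blast+
    moreover have "disjnt (?Y \<inter> S) (?Y \<inter> T)"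
      using d by (auto simp: disjnt_def)
    ultimately obtain A B where AB: "openin (subtopology X ?Y) A" "openin (subtopology X ?Y) B"
        "?Y \<inter> S \<subseteq> A" "?Y \<inter> T \<subseteq> B" "disjnt A B"
      using metrizable_imp_normal_space[OF m] unfolding normal_space_def by meson
    have "openin X A" "openin X B"
      using AB(1,2) oY openin_trans_full by blast+
    have "openin X (A \<union> V)" "openin X (B - C)"
      using \<open>openin X A\<close> \<open>openin X B\<close> VC by auto
    moreover have "S \<subseteq> A \<union> V"
      using AB(3) VC(3) closedin_subset[OF S] by auto
    moreover have "T \<subseteq> B - C"
      using AB(4) VC(5) closedin_subset[OF T] pT by auto
    moreover have "disjnt (A \<union> V) (B - C)"
      using AB(5) VC(4) by (auto simp: disjnt_def)
    ultimately show ?thesis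
      by meson
  qed
  have "normal_space X"
    unfolding normal_space_def
  proof (intro allI impI, elim conjE)
    fix S T
    assume *: "closedin X S" "closedin X T" "disjnt S T"
    show "\<exists>U V. openin X U \<and> openin X V \<and> S \<subseteq> U \<and> T \<subseteq> V \<and> disjnt U V"
    proof (cases "p \<in> T")
      case True
      then have "p \<notin> S"
        using *(3) by (auto simp: disjnt_def)
      then show ?thesis
        using sep[OF *(2,1)] *(3) by (metis disjnt_sym)
    qed (use sep * in blast)
  qed
  moreover have "gdelta_in X C" if C: "closedin X C" for C
  proof -
    have "gdelta_in (subtopology X ?Y) (?Y \<inter> C)"
      using closed_imp_gdelta_in[OF m] C closedin_subtopology_Int_closed by blast
    then have G: "gdelta_in X (?Y \<inter> C)"
      using gdelta_in_gdelta_subtopology[OF open_imp_gdelta_in[OF oY]] by blast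
    show ?thesis
    proof (cases "p \<in> C")
      case True
      then have "C = (?Y \<inter> C) \<union> {p}"
        using closedin_subset[OF C] by auto
      then show ?thesis
        using gdelta_in_Un[OF G g] by simp
    next
      case False
      then have "C = ?Y \<inter> C"
        using closedin_subset[OF C] by auto
      then show ?thesis
        using G by simp
    qed
  qed
  ultimately show ?thesis
    using T1 normal_t1_imp_Hausdorff_space by (simp add: perfectly_normal_space_def)
qed

section \<open>Invariance of almost metrizability and weight under homeomorphism\<close>

lemma homeomorphic_map_image_preimage:
  "homeomorphic_map X Y f \<Longrightarrow> C \<subseteq> topspace Y \<Longrightarrow> f ` {x \<in> topspace X. f x \<in> C} = C"
  by (auto simp: homeomorphic_eq_everything_map)

lemma homeomorphic_almost_metrizable_space:
  assumes h: "X homeomorphic_space Y" and X: "almost_metrizable_space X"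
  shows "almost_metrizable_space Y"
proof -
  obtain f where f: "homeomorphic_map X Y f"
    using h homeomorphic_space[of X Y] by blast
  obtain x where x: "x \<in> topspace X" and m: "metrizable_space (subtopology X (topspace X - {x}))"
    using X unfolding almost_metrizable_space_def by blast
  have "f ` (topspace X - {x}) = topspace Y - {f x}"
    using f x by (auto simp: homeomorphic_eq_everything_map inj_on_def)
  then have "homeomorphic_map (subtopology X (topspace X - {x})) (subtopology Y (topspace Y - {f x})) f"
    by (intro homeomorphic_map_subtopologies[OF f]) (simp add: Int_absorb1)
  then have "metrizable_space (subtopology Y (topspace Y - {f x}))"
    using m homeomorphic_metrizable_space[OF homeomorphic_map_imp_homeomorphic_space] by blast
  moreover have "f x \<in> topspace Y"
    using f x homeomorphic_imp_surjective_map by blast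
  moreover have "gdelta_in Y C" if C: "closedin Y C" for C
  proof -
    let ?D = "{x \<in> topspace X. f x \<in> C}"
    have "closedin X ?D"
      using closedin_continuous_map_preimage[OF homeomorphic_imp_continuous_map[OF f] C] .
    then have "gdelta_in X ?D"
      using X unfolding almost_metrizable_space_def perfectly_normal_space_def by blast
    then have "gdelta_in Y (f ` ?D)"
      using homeomorphic_map_gdeltaness[OF f, of ?D] by blast
    then show ?thesis
      unfolding homeomorphic_map_image_preimage[OF f closedin_subset[OF C]] .
  qed
  ultimately show ?thesis
    using X unfolding almost_metrizable_space_def perfectly_normal_space_def
      homeomorphic_normal_space[OF h] homeomorphic_Hausdorff_space[OF h] by blast
qed

lemma base_of_topology_homeomorphic_image:
  assumes f: "homeomorphic_map X Y f" and B: "base_of_topology X B"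
  shows "base_of_topology Y ((`) f ` B)"
  unfolding base_of_topology_def
proof (intro conjI ballI allI impI)
  show "openin Y V" if "V \<in> (`) f ` B" for V
    using that B homeomorphic_imp_open_map[OF f] by (auto simp: base_of_topology_def open_map_def)
  fix U assume U: "openin Y U"
  let ?U = "{x \<in> topspace X. f x \<in> U}"
  have "openin X ?U"
    using openin_continuous_map_preimage[OF homeomorphic_imp_continuous_map[OF f] U] .
  then have "\<exists>C\<subseteq>B. ?U = \<Union>C"
    using B[unfolded base_of_topology_def, THEN conjunct2, rule_format] by blast
  then obtain C where C: "C \<subseteq> B" "?U = \<Union>C"
    by (elim exE conjE)
  have "U = \<Union>((`) f ` C)"
    using homeomorphic_map_image_preimage[OF f openin_subset[OF U]] C(2) by (simp flip: image_Union)
  then show "\<exists>\<U>\<subseteq>(`) f ` B. U = \<Union>\<U>"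
    using image_mono[OF C(1), of "(`) f"] by blast
qed

lemma homeomorphic_has_weight:
  assumes h: "X homeomorphic_space Y" and w: "has_weight X r"
  shows "has_weight Y r"
proof -
  obtain f g where fg: "homeomorphic_map X Y f" "homeomorphic_map Y X g"
    using h homeomorphic_space[of X Y] homeomorphic_space[of Y X] homeomorphic_space_sym[of X Y] by blast
  have least: "r \<le>o |C|" if C: "base_of_topology Y C" for C
  proof -
    have "r \<le>o |(`) g ` C|"
      using w base_of_topology_homeomorphic_image[OF fg(2) C] unfolding has_weight_def by blast
    then show ?thesis
      using card_of_image ordLeq_transitive by blast
  qed
  obtain B where B: "base_of_topology X B" "|B| =o r"
    using w unfolding has_weight_def by blast
  have "base_of_topology Y ((`) f ` B)"
    by (rule base_of_topology_homeomorphic_image[OF fg(1) B(1)])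
  moreover have "|(`) f ` B| =o r"
    using ordLeq_ordIso_trans[OF card_of_image B(2)] least[OF calculation] ordIso_iff_ordLeq by blast
  ultimately show ?thesis
    using least unfolding has_weight_def by blast
qed

text \<open>Two points of \<open>V\<close> are joined by a path through \<open>z\<close>, each half
  running inside its own \<open>T \<subseteq> V\<close>.\<close>

lemma path_connectedin_star:
  assumes "\<And>y. y \<in> V \<Longrightarrow> \<exists>T. path_connectedin X T \<and> T \<subseteq> V \<and> z \<in> T \<and> y \<in> T"
  shows "path_connectedin X V"
proof -
  have pc: "path_component_of (subtopology X V) z y" if "y \<in> V" for y
    using assms[OF that] unfolding path_component_of by (meson path_connectedin_subtopology)
  have "V \<subseteq> topspace X"
    using assms path_connectedin_subset_topspace[of X] by blast
  moreover have "path_component_of (subtopology X V) x y" if "x \<in> V" "y \<in> V" for x y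
    using path_component_of_trans[OF path_component_of_sym[OF pc] pc] that by blast
  ultimately show ?thesis
    unfolding path_connectedin_def path_connected_space_iff_path_component topspace_subtopology
    by blast
qed

subsection \<open>The metric tree\<close>

type_synonym 'a point = "('a \<times> nat) list \<times> real"

text \<open>Lists grow at the head, so the parent of \<open>c # s\<close> is \<open>s\<close> and ancestors are suffixes.\<close>

definition nodes :: "'a rel \<Rightarrow> ('a \<times> nat) list set" where
  "nodes r = {s. fst ` set s \<subseteq> Field r \<and> sorted_wrt (\<lambda>a b. (fst a, fst b) \<in> r - Id) s}"

text \<open>The empty list has no segment leading to it. Parameter 1 makes \<open>(s, 1)\<close> the
  node \<open>s\<close> for every list, the root included.\<close>

definition apex :: "'a point" where
  "apex = ([], 1)"

text \<open>\<open>(s, t)\<close> is the point at distance \<open>t\<close> from the parent of \<open>s\<close> on the segment joining it to \<open>s\<close>.\<close>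

definition tree :: "'a rel \<Rightarrow> 'a point set" where
  "tree r = {(s, t). s \<in> nodes r \<and> 0 < t \<and> t \<le> 1 \<and> (s = [] \<longrightarrow> t = 1)}"

text \<open>Coordinates embedding the tree into the bounded functions. Their sup distance is not the path
  metric, but it agrees with it along each segment and induces the same topology.\<close>

definition height :: "'a point \<Rightarrow> ('a \<times> nat) list \<Rightarrow> real" where
  "height x u = (if u = fst x then snd x else if suffix u (fst x) then 1 else 0)"

definition tdist :: "'a point \<Rightarrow> 'a point \<Rightarrow> real" where
  "tdist x y = (SUP u. \<bar>height x u - height y u\<bar>)"

text \<open>Points of \<open>tree\<close> have positive parameters so that each has a single name.
  The lower end of a segment is therefore named by its parent, and \<open>edge s\<close>
  parametrises the closed segment over [0, 1].\<close>

definition edge :: "('a \<times> nat) list \<Rightarrow> real \<Rightarrow> 'a point" where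
  "edge s a = (if a = 0 then (tl s, 1) else (s, a))"

lemma not_suffix_Cons [simp]: "\<not> suffix (c # s) s"
  using suffix_length_le by fastforce

lemma nodes_Nil [simp]: "[] \<in> nodes r"
  by (simp add: nodes_def)

lemma nodes_Cons:
  "c # s \<in> nodes r \<longleftrightarrow> fst c \<in> Field r \<and> (\<forall>b\<in>set s. (fst c, fst b) \<in> r - Id) \<and> s \<in> nodes r"
  by (auto simp: nodes_def)

lemma nodes_single [simp]: "[c] \<in> nodes r \<longleftrightarrow> fst c \<in> Field r"
  by (simp add: nodes_Cons)

lemma nodes_tl: "s \<in> nodes r \<Longrightarrow> tl s \<in> nodes r"
  by (cases s) (auto simp: nodes_Cons)

lemma apex_in_tree [simp]: "apex \<in> tree r"
  by (simp add: apex_def tree_def)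

lemma tree_iff: "(s, t) \<in> tree r \<longleftrightarrow> s \<in> nodes r \<and> 0 < t \<and> t \<le> 1 \<and> (s = [] \<longrightarrow> t = 1)"
  by (simp add: tree_def)

lemma tree_apex_iff: "(s, t) \<in> tree r \<Longrightarrow> (s, t) = apex \<longleftrightarrow> s = []"
  by (auto simp: tree_def apex_def)

lemma node_in_tree [simp]: "s \<in> nodes r \<Longrightarrow> (s, 1) \<in> tree r"
  by (simp add: tree_iff)

lemma edge_in_tree: "s \<in> nodes r \<Longrightarrow> s \<noteq> [] \<Longrightarrow> 0 \<le> a \<Longrightarrow> a \<le> 1 \<Longrightarrow> edge s a \<in> tree r"
  by (auto simp: edge_def tree_iff nodes_tl)

lemma edge_pos: "a \<noteq> 0 \<Longrightarrow> edge s a = (s, a)"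
  by (simp add: edge_def)

lemma edge_Cons_0: "edge (c # s) 0 = (s, 1)"
  by (simp add: edge_def)

text \<open>The formula also covers \<open>a = 0\<close>, where the parent has coordinate 1 exactly
  at the proper suffixes of \<open>s\<close>. Along a segment only the coordinate \<open>s\<close>
  varies, and it does so with unit speed.\<close>

lemma height_edge:
  assumes "s \<noteq> []"
  shows "height (edge s a) u = (if u = s then a else if suffix u s then 1 else 0)"
proof (cases s)
  case (Cons c s')
  then show ?thesis
    by (auto simp: height_def edge_def suffix_Cons)
qed (use assms in simp)

lemma height_bounds: "x \<in> tree r \<Longrightarrow> 0 \<le> height x u \<and> height x u \<le> 1"
  by (auto simp: height_def tree_def)

lemma height_Nil: "x \<in> tree r \<Longrightarrow> height x [] = 1"
  by (auto simp: height_def tree_def)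

lemma height_apex: "u \<noteq> [] \<Longrightarrow> height apex u = 0"
  by (auto simp: height_def apex_def)

lemma height_pos_iff: "x \<in> tree r \<Longrightarrow> 0 < height x u \<longleftrightarrow> suffix u (fst x)"
  by (auto simp: height_def tree_def)

text \<open>The list of a point is the longest one with positive coordinate, and the parameter is
  the coordinate there.\<close>

lemma height_inj:
  assumes x: "x \<in> tree r" and y: "y \<in> tree r" and eq: "height x = height y"
  shows "x = y"
proof -
  have "suffix (fst x) (fst y)" "suffix (fst y) (fst x)"
    using height_pos_iff[OF x] height_pos_iff[OF y] eq by auto
  then have "fst x = fst y"
    by (simp add: suffix_order.eq_iff)
  moreover have "snd x = snd y"
    using fun_cong[OF eq, of "fst x"] \<open>fst x = fst y\<close> by (simp add: height_def)
  ultimately show ?thesis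
    by (simp add: prod_eq_iff)
qed

text \<open>The bound includes points outside the tree, whose parameters are arbitrary reals,
  because nonnegativity of the distance is demanded for all points.\<close>

lemma tdist_bdd: "bdd_above (range (\<lambda>u. \<bar>height x u - height y u\<bar>))"
proof (rule bdd_aboveI2)
  have "\<bar>height z u\<bar> \<le> 1 + \<bar>snd z\<bar>" for z :: "'a point" and u
    by (auto simp: height_def)
  then show "\<bar>height x u - height y u\<bar> \<le> (1 + \<bar>snd x\<bar>) + (1 + \<bar>snd y\<bar>)" for u
    by (meson abs_triangle_ineq4 add_mono order_trans)
qed

lemma height_le_tdist: "\<bar>height x u - height y u\<bar> \<le> tdist x y"
  unfolding tdist_def by (rule cSUP_upper[OF _ tdist_bdd]) simp

lemma tdist_le: "(\<And>u. \<bar>height x u - height y u\<bar> \<le> e) \<Longrightarrow> tdist x y \<le> e"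
  unfolding tdist_def by (rule cSUP_least) auto

interpretation tree: Metric_space "tree r" tdist for r :: "'a rel"
proof
  fix x y z :: "'a point"
  show "0 \<le> tdist x y"
    using height_le_tdist[of x undefined y] by linarith
  show "tdist x y = tdist y x"
    by (simp add: tdist_def abs_minus_commute)
  show "tdist x z \<le> tdist x y + tdist y z"
  proof (rule tdist_le)
    show "\<bar>height x u - height z u\<bar> \<le> tdist x y + tdist y z" for u
      using height_le_tdist[of x u y] height_le_tdist[of y u z] by linarith
  qed
  show "tdist x y = 0 \<longleftrightarrow> x = y" if "x \<in> tree r" "y \<in> tree r"
  proof
    assume "tdist x y = 0"
    then have "height x u = height y u" for u
      using height_le_tdist[of x u y] by simp
    then show "x = y"
      using height_inj[OF that] by blast
  next
    show "tdist x y = 0" if "x = y"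
      using that by (simp add: tdist_def)
  qed
qed

abbreviation tree_top :: "'a rel \<Rightarrow> 'a point topology" where
  "tree_top r \<equiv> tree.mtopology r"

lemma tdist_edge:
  assumes "s \<noteq> []"
  shows "tdist (edge s a) (edge s b) = \<bar>a - b\<bar>"
proof (rule antisym)
  show "tdist (edge s a) (edge s b) \<le> \<bar>a - b\<bar>"
    by (rule tdist_le) (simp add: height_edge[OF assms])
  show "\<bar>a - b\<bar> \<le> tdist (edge s a) (edge s b)"
    using height_le_tdist[of "edge s a" s "edge s b"] by (simp add: height_edge[OF assms])
qed

text \<open>Each coordinate is 1-Lipschitz for the sup distance.\<close>

lemma continuous_map_height: "continuous_map (tree_top r) euclideanreal (\<lambda>x. height x u)"
proof -
  have "\<exists>\<delta>>0. \<forall>y. y \<in> tree r \<and> tdist x y < \<delta> \<longrightarrow> height y u \<in> mball_of euclidean_metric (height x u) e"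
    if "e > 0" for x :: "'a point" and e
  proof (intro exI conjI allI impI)
    show "height y u \<in> mball_of euclidean_metric (height x u) e" if "y \<in> tree r \<and> tdist x y < e" for y
      using that height_le_tdist[of x u y] by (simp add: dist_real_def)
  qed (use that in simp)
  then show ?thesis
    by (simp add: tree.metric_continuous_map[OF Met_TC.Metric_space_axioms, simplified] dist_real_def abs_minus_commute)
qed

lemma openin_height:
  "open W \<Longrightarrow> openin (tree_top r) {x \<in> tree r. height x u \<in> W}"
  using openin_continuous_map_preimage[OF continuous_map_height[of r u], of W] by simp

text \<open>Since \<open>e \<le> t\<close>, the coordinate \<open>s\<close> of \<open>y\<close>
  stays positive, so the list of \<open>y\<close> extends \<open>s\<close>. Two or more additional
  entries would give \<open>y\<close> the coordinate 1 at a child of \<open>s\<close>, where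
  \<open>(s, t)\<close> has 0; this is too far because \<open>e \<le> 1\<close>.\<close>

lemma mball_cases:
  assumes x: "(s, t) \<in> tree r" and e: "0 < e" "e \<le> t" and y: "y \<in> tree.mball r (s, t) e"
  obtains t' where "y = (s, t')" "0 < t'" "t' \<le> 1" "\<bar>t' - t\<bar> < e"
  | c t' where "y = (c # s, t')" "c # s \<in> nodes r" "0 < t'" "t' < e" "1 - t < e"
proof -
  have yT: "y \<in> tree r" and d: "tdist (s, t) y < e"
    using y by auto
  obtain s' t' where y': "y = (s', t')"
    by fastforce
  have t01: "0 < t" "t \<le> 1"
    using x by (auto simp: tree_iff)
  have D: "\<bar>height (s, t) u - height y u\<bar> < e" for u
    using height_le_tdist[of "(s, t)" u y] d by linarith
  have "0 < height y s"
    using D[of s] e by (simp add: height_def)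
  then have "suffix s s'"
    using height_pos_iff[OF yT] y' by simp
  then obtain p where p: "s' = p @ s"
    by (auto simp: suffix_def)
  show thesis
  proof (cases p rule: rev_cases)
    case Nil
    then show ?thesis
      using that(1)[of t'] D[of s] yT y' p by (auto simp: height_def tree_iff)
  next
    case (snoc q c)
    have "height (s, t) (c # s) = 0"
      by (simp add: height_def suffix_Cons)
    then have h: "height y (c # s) < e"
      using D[of "c # s"] by linarith
    have "q = []"
    proof (rule ccontr)
      assume "q \<noteq> []"
      then have "height y (c # s) = 1"
        using p y' snoc by (auto simp: height_def suffix_def)
      then show False
        using h e t01 by simp
    qed
    moreover have "1 - t < e"
      using D[of s] p y' snoc by (auto simp: height_def suffix_def)
    ultimately show ?thesis
      using that(2)[of c t'] p y' snoc yT h by (auto simp: tree_iff height_def)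
  qed
qed

subsection \<open>Filters as neighbourhoods of the root\<close>

text \<open>The coordinate \<open>[c]\<close> is positive only on the branch \<open>c\<close> at the
  root, and there it is the distance from the root cut off at 1. The set thus consists of a collar
  of width 1/(n+1) on every branch, together with the entire branches selected by \<open>E\<close>
  and \<open>n\<close>.\<close>

definition nbhd :: "'a rel \<Rightarrow> ('i \<Rightarrow> 'a set) \<Rightarrow> 'i set \<Rightarrow> nat \<Rightarrow> 'a point set" where
  "nbhd r I E n = {x \<in> tree r. x = apex \<or>
     (\<exists>c. 0 < height x [c] \<and>
       (height x [c] < inverse (Suc n) \<or> fst c \<in> (\<Inter>i\<in>E. I i) \<and> n \<le> snd c))}"

text \<open>Testing \<open>U - {apex}\<close> against the metric keeps the tree topology off the
  root; at the root the sets \<open>nbhd r I E n\<close> with finite \<open>E \<subseteq> J\<close>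
  form a neighbourhood base.\<close>

definition ftree :: "'a rel \<Rightarrow> ('i \<Rightarrow> 'a set) \<Rightarrow> 'i set \<Rightarrow> 'a point topology" where
  "ftree r I J = topology (\<lambda>U. U \<subseteq> tree r \<and> openin (tree_top r) (U - {apex}) \<and>
     (apex \<in> U \<longrightarrow> (\<exists>E n. finite E \<and> E \<subseteq> J \<and> nbhd r I E n \<subseteq> U)))"

lemma apex_in_nbhd [simp]: "apex \<in> nbhd r I E n"
  by (simp add: nbhd_def)

lemma nbhd_mono: "E \<subseteq> E' \<Longrightarrow> n \<le> n' \<Longrightarrow> nbhd r I E' n' \<subseteq> nbhd r I E n"
proof -
  assume *: "E \<subseteq> E'" "n \<le> n'"
  then have "inverse (real (Suc n')) \<le> inverse (real (Suc n))"
    by (intro le_imp_inverse_le) auto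
  then have "x \<in> nbhd r I E n" if x: "x \<in> nbhd r I E' n'" for x
  proof (cases "x = apex")
    case False
    then obtain c where c: "0 < height x [c]"
        "height x [c] < inverse (Suc n') \<or> fst c \<in> (\<Inter>i\<in>E'. I i) \<and> n' \<le> snd c"
      using x unfolding nbhd_def by blast
    have "height x [c] < inverse (Suc n') \<Longrightarrow> height x [c] < inverse (Suc n)"
      using \<open>inverse (real (Suc n')) \<le> inverse (real (Suc n))\<close> by linarith
    then have "height x [c] < inverse (Suc n) \<or> fst c \<in> (\<Inter>i\<in>E. I i) \<and> n \<le> snd c"
      using c(2) * by (elim disjE conjE) (blast, blast intro: order_trans)
    then show ?thesis
      using c(1) x unfolding nbhd_def by blast
  qed (simp add: nbhd_def)
  then show ?thesis
    by blast
qed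

lemma openin_ftree:
  "openin (ftree r I J) U \<longleftrightarrow> U \<subseteq> tree r \<and> openin (tree_top r) (U - {apex}) \<and>
     (apex \<in> U \<longrightarrow> (\<exists>E n. finite E \<and> E \<subseteq> J \<and> nbhd r I E n \<subseteq> U))"
proof -
  let ?L = "\<lambda>U. U \<subseteq> tree r \<and> openin (tree_top r) (U - {apex}) \<and>
     (apex \<in> U \<longrightarrow> (\<exists>E n. finite E \<and> E \<subseteq> J \<and> nbhd r I E n \<subseteq> U))"
  have "istopology ?L"
    unfolding istopology_def
  proof (intro conjI allI impI)
    fix S T assume S: "?L S" and T: "?L T"
    show "S \<inter> T \<subseteq> tree r" using S by auto
    have "S \<inter> T - {apex} = (S - {apex}) \<inter> (T - {apex})" by auto
    then show "openin (tree_top r) (S \<inter> T - {apex})" using S T by auto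
    assume a: "apex \<in> S \<inter> T"
    obtain E n where E: "finite E" "E \<subseteq> J" "nbhd r I E n \<subseteq> S" using S a by auto
    obtain F m where F: "finite F" "F \<subseteq> J" "nbhd r I F m \<subseteq> T" using T a by auto
    have "nbhd r I (E \<union> F) (max n m) \<subseteq> S \<inter> T"
      using E(3) F(3) nbhd_mono[of E "E \<union> F" n "max n m" r I] nbhd_mono[of F "E \<union> F" m "max n m" r I] by auto
    then show "\<exists>E n. finite E \<and> E \<subseteq> J \<and> nbhd r I E n \<subseteq> S \<inter> T"
      using E F by (intro exI[of _ "E \<union> F"] exI[of _ "max n m"]) auto
  next
    fix K assume K: "\<forall>k\<in>K. ?L k"
    show "\<Union>K \<subseteq> tree r" using K by auto
    have "\<Union>K - {apex} = (\<Union>k\<in>K. k - {apex})" by auto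
    moreover have "openin (tree_top r) (\<Union>k\<in>K. k - {apex})"
      using K by (intro openin_clauses(3)) blast
    ultimately show "openin (tree_top r) (\<Union>K - {apex})" by simp
    assume "apex \<in> \<Union>K"
    then obtain k where "k \<in> K" "apex \<in> k" by auto
    then obtain E n where "finite E" "E \<subseteq> J" "nbhd r I E n \<subseteq> k"
      using K by auto
    then show "\<exists>E n. finite E \<and> E \<subseteq> J \<and> nbhd r I E n \<subseteq> \<Union>K"
      using \<open>k \<in> K\<close> by (intro exI[of _ E] exI[of _ n]) auto
  qed
  then show ?thesis
    by (simp add: ftree_def topology_inverse')
qed

lemma openin_ftree_nbhd:
  assumes "openin (ftree r I J) U" "apex \<in> U"
  obtains E n where "finite E" "E \<subseteq> J" "nbhd r I E n \<subseteq> U"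
  using assms unfolding openin_ftree by (elim conjE impE exE) simp_all

lemma openin_tree_minus_apex: "openin (tree_top r) (tree r - {apex})"
  using tree.t1_space_mtopology[of r] openin_topspace[of "tree_top r"]
  unfolding t1_space_openin_delete_alt by simp

lemma topspace_ftree [simp]: "topspace (ftree r I J) = tree r"
proof -
  have "openin (ftree r I J) (tree r)"
    using openin_tree_minus_apex by (auto simp: openin_ftree nbhd_def intro!: exI[of _ "{}"])
  moreover have "topspace (ftree r I J) \<subseteq> tree r"
    using openin_topspace openin_ftree by blast
  ultimately show ?thesis
    by (simp add: openin_subset subset_antisym)
qed

lemma openin_ftree_off_apex:
  "apex \<notin> U \<Longrightarrow> openin (ftree r I J) U \<longleftrightarrow> openin (tree_top r) U"
  using openin_subset[of "tree_top r" U] by (auto simp: openin_ftree)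

text \<open>Off the root the set is a union over \<open>c\<close> of preimages under the coordinate
  \<open>[c]\<close>: of all positive values for the branches taken entire, of the values between 0
  and 1/(n+1) for the others.\<close>

lemma openin_nbhd:
  fixes r :: "'a rel"
  assumes "finite E" "E \<subseteq> J"
  shows "openin (ftree r I J) (nbhd r I E n)"
proof -
  let ?W = "\<lambda>c. if fst c \<in> (\<Inter>i\<in>E. I i) \<and> n \<le> snd c then {0<..} else {0<..<inverse (real (Suc n))}"
  have W: "h \<in> ?W c \<longleftrightarrow> 0 < h \<and> (h < inverse (Suc n) \<or> fst c \<in> (\<Inter>i\<in>E. I i) \<and> n \<le> snd c)" for h c
    by auto
  have nz: "0 < height x [c] \<Longrightarrow> x \<noteq> apex" for x :: "'a point" and c
    by (auto simp: height_apex)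
  have "nbhd r I E n - {apex} = (\<Union>c. {x \<in> tree r. height x [c] \<in> ?W c})"
  proof (rule set_eqI)
    fix x
    show "x \<in> nbhd r I E n - {apex} \<longleftrightarrow> x \<in> (\<Union>c. {x \<in> tree r. height x [c] \<in> ?W c})"
      unfolding W nbhd_def using nz[of x] by blast
  qed
  moreover have "openin (tree_top r) (\<Union>c. {x \<in> tree r. height x [c] \<in> ?W c})"
    by (intro openin_clauses(3) ballI) (auto intro: openin_height)
  moreover have "nbhd r I E n \<subseteq> tree r"
    by (auto simp: nbhd_def)
  ultimately show ?thesis
    using assms unfolding openin_ftree by auto
qed

lemma subtopology_ftree:
  "subtopology (ftree r I J) (tree r - {apex}) = subtopology (tree_top r) (tree r - {apex})"
  unfolding topology_eq
proof
  fix S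
  have o: "openin (ftree r I J) (tree r - {apex})"
    by (simp add: openin_ftree_off_apex openin_tree_minus_apex)
  show "openin (subtopology (ftree r I J) (tree r - {apex})) S \<longleftrightarrow>
      openin (subtopology (tree_top r) (tree r - {apex})) S"
    unfolding openin_open_subtopology[OF o] openin_open_subtopology[OF openin_tree_minus_apex]
    using openin_ftree_off_apex[of S r I J] by blast
qed

lemma metrizable_ftree_off_apex:
  "metrizable_space (subtopology (ftree r I J) (topspace (ftree r I J) - {apex}))"
  by (simp add: subtopology_ftree metrizable_space_subtopology tree.metrizable_space_mtopology)

section \<open>Closed neighbourhoods of the root and almost metrizability\<close>

lemma tree_root:
  assumes "x \<in> tree r" "x \<noteq> apex"
  obtains c where "suffix [c] (fst x)" "0 < height x [c]"
proof -
  have "fst x \<noteq> []"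
    using assms tree_apex_iff[of "fst x" "snd x" r] by auto
  \<comment> \<open>Lists grow at the head, so the last entry names the branch at the root.\<close>
  then have "suffix [last (fst x)] (fst x)"
    by (metis append_butlast_last_id suffix_def)
  then show ?thesis
    using that height_pos_iff[OF assms(1)] by blast
qed

lemma height_root_unique:
  "x \<in> tree r \<Longrightarrow> 0 < height x [c] \<Longrightarrow> 0 < height x [c'] \<Longrightarrow> c = c'"
  using height_pos_iff[of x r] suffix_same_cases by (fastforce simp: suffix_Cons)

text \<open>A point lies on only one branch at the root, so the witness in \<open>nbhd\<close> must
  be this \<open>c\<close>.\<close>

lemma nbhd_subset_root:
  assumes "x \<in> nbhd r I E n" "0 < height x [c]"
  shows "height x [c] < inverse (Suc n) \<or> fst c \<in> (\<Inter>i\<in>E. I i) \<and> n \<le> snd c"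
proof -
  have x: "x \<in> tree r" "x \<noteq> apex"
    using assms by (auto simp: nbhd_def height_apex)
  then obtain c' where c': "0 < height x [c']"
      "height x [c'] < inverse (Suc n) \<or> fst c' \<in> (\<Inter>i\<in>E. I i) \<and> n \<le> snd c'"
    using assms unfolding nbhd_def by blast
  then show ?thesis
    using height_root_unique[OF x(1) assms(2) c'(1)] by simp
qed

text \<open>This is where the copy numbers act: an index above \<open>snd c\<close> prevents the
  branch \<open>c\<close> from being taken entire, whatever \<open>I\<close> and \<open>E\<close>
  are, and leaves only a collar that can be made narrower than \<open>d\<close>.\<close>

lemma eventually_not_nbhd:
  assumes "0 < d"
  obtains n where "\<And>x I E. x \<in> nbhd r I E (Suc n) \<Longrightarrow> height x [c] < d"
proof -
  obtain k where k: "inverse (real (Suc k)) < d"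
    using reals_Archimedean[OF assms] by blast
  define n where "n = max k (snd c)"
  have "inverse (real (Suc (Suc n))) \<le> inverse (real (Suc k))"
    by (intro le_imp_inverse_le) (auto simp: n_def)
  then have "height x [c] < d" if "x \<in> nbhd r I E (Suc n)" for x I E
  proof (cases "0 < height x [c]")
    case True
    have "\<not> Suc n \<le> snd c"
      by (simp add: n_def)
    then show ?thesis
      using nbhd_subset_root[OF that True] k \<open>inverse (real (Suc (Suc n))) \<le> inverse (real (Suc k))\<close>
      by linarith
  qed (use assms in linarith)
  then show ?thesis
    by (rule that)
qed

text \<open>On the branches not taken entire at stage \<open>Suc n\<close>, remove the points beyond
  1/(n+2). The remaining closed condition, at most 1/(n+2), lies between the open ones, below
  1/(n+2) and below 1/(n+1).\<close>

lemma nbhd_closed_between: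
  assumes "finite E" "E \<subseteq> J"
  shows "\<exists>C. closedin (ftree r I J) C \<and> nbhd r I E (Suc n) \<subseteq> C \<and> C \<subseteq> nbhd r I E n"
proof -
  define W where "W = (\<lambda>c. if fst c \<in> (\<Inter>i\<in>E. I i) \<and> Suc n \<le> snd c then {} else {inverse (real (Suc (Suc n)))<..})"
  define U where "U = (\<Union>c. {x \<in> tree r. height x [c] \<in> W c})"
  have "openin (tree_top r) U"
    unfolding U_def by (intro openin_clauses(3) ballI) (auto intro: openin_height simp: W_def)
  moreover have "apex \<notin> U"
    by (auto simp: U_def W_def height_apex split: if_splits)
  ultimately have "openin (ftree r I J) U"
    by (simp add: openin_ftree_off_apex)
  moreover have lt: "inverse (real (Suc (Suc n))) < inverse (real (Suc n))"
    by (intro less_imp_inverse_less) auto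
  have "nbhd r I E (Suc n) \<inter> U = {}"
  proof -
    have False if x: "x \<in> nbhd r I E (Suc n)" "x \<in> U" for x
    proof -
      obtain c where c: "height x [c] \<in> W c"
        using x(2) unfolding U_def by blast
      then have *: "inverse (real (Suc (Suc n))) < height x [c]"
          "\<not> (fst c \<in> (\<Inter>i\<in>E. I i) \<and> Suc n \<le> snd c)"
        by (auto simp: W_def split: if_splits)
      have "0 < inverse (real (Suc (Suc n)))"
        by simp
      then have "0 < height x [c]"
        using *(1) by (rule less_trans)
      then show False
        using nbhd_subset_root[OF x(1), of c] * by linarith
    qed
    then show ?thesis by auto
  qed
  moreover have "tree r - U \<subseteq> nbhd r I E n"
  proof
    fix x assume x: "x \<in> tree r - U"
    show "x \<in> nbhd r I E n"
    proof (cases "x = apex")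
      case False
      then obtain c where c: "0 < height x [c]"
        using tree_root x by (metis DiffD1)
      have "height x [c] \<notin> W c"
        using x by (auto simp: U_def)
      then have "\<not> inverse (real (Suc (Suc n))) < height x [c] \<or> fst c \<in> (\<Inter>i\<in>E. I i) \<and> Suc n \<le> snd c"
        by (auto simp: W_def split: if_splits)
      then have "height x [c] < inverse (Suc n) \<or> fst c \<in> (\<Inter>i\<in>E. I i) \<and> n \<le> snd c"
        using lt by (elim disjE) (linarith, simp)
      then show ?thesis
        using x c by (auto simp: nbhd_def)
    qed simp
  qed
  ultimately show ?thesis
    using closedin_diff[OF closedin_topspace, of "ftree r I J" U] nbhd_def[of r I E "Suc n"]
    by (intro exI[of _ "tree r - U"]) auto
qed

lemma nbhd_separates:
  assumes "y \<in> tree r" "y \<noteq> apex"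
  obtains n where "y \<notin> nbhd r I {} n"
proof -
  obtain c where c: "0 < height y [c]"
    using tree_root assms by metis
  obtain n where n: "\<And>x. x \<in> nbhd r I {} (Suc n) \<Longrightarrow> height x [c] < height y [c]"
    using eventually_not_nbhd[OF c] by metis
  then have "y \<notin> nbhd r I {} (Suc n)"
    by blast
  then show ?thesis
    using that by blast
qed

lemma t1_ftree: "t1_space (ftree r I J)"
  unfolding t1_space_def
proof (intro ballI impI)
  fix x y assume xy: "x \<in> topspace (ftree r I J)" "y \<in> topspace (ftree r I J)" "x \<noteq> y"
  show "\<exists>U. openin (ftree r I J) U \<and> x \<in> U \<and> y \<notin> U"
  proof (cases "x = apex")
    case True
    then obtain n where "y \<notin> nbhd r I {} n"
      using nbhd_separates xy by (metis topspace_ftree)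
    then show ?thesis
      using openin_nbhd[of "{}" J r I n] True by auto
  next
    case False
    have "openin (tree_top r) (tree r - {apex} - {y})"
      using openin_tree_minus_apex tree.t1_space_mtopology[of r]
      unfolding t1_space_openin_delete_alt by simp
    then have "openin (ftree r I J) (tree r - {apex} - {y})"
      by (simp add: openin_ftree_off_apex)
    then show ?thesis
      using xy False by (intro exI[of _ "tree r - {apex} - {y}"]) auto
  qed
qed

text \<open>The countably many sets \<open>nbhd r I {} n\<close> meet only in the root, whatever
  \<open>J\<close> is. Closed neighbourhoods at the root come from
  \<open>nbhd_closed_between\<close>, and off the root the topology is that of the metric.\<close>

lemma almost_metrizable_ftree: "almost_metrizable_space (ftree r I J)"
proof -
  have eq: "{apex} = \<Inter>(range (\<lambda>n. nbhd r I {} n))"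
  proof -
    have "x = apex" if x: "\<And>n. x \<in> nbhd r I {} n" for x
    proof (rule ccontr)
      assume "x \<noteq> apex"
      moreover have "x \<in> tree r"
        using x[of 0] by (simp add: nbhd_def)
      ultimately show False
        using nbhd_separates x by metis
    qed
    then show ?thesis by auto
  qed
  have "(countable intersection_of openin (ftree r I J)) {apex}"
    unfolding intersection_of_def
    by (rule exI[of _ "range (\<lambda>n. nbhd r I {} n)"]) (use eq openin_nbhd[of "{}" J r I] in auto)
  then have "gdelta_in (ftree r I J) {apex}"
    by (simp add: gdelta_in_alt)
  moreover have "\<exists>V C. openin (ftree r I J) V \<and> closedin (ftree r I J) C \<and> apex \<in> V \<and> V \<subseteq> C \<and> C \<subseteq> U"
    if U: "openin (ftree r I J) U" "apex \<in> U" for U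
  proof -
    obtain E n where E: "finite E" "E \<subseteq> J" "nbhd r I E n \<subseteq> U"
      by (rule openin_ftree_nbhd[OF U])
    obtain C where "closedin (ftree r I J) C" "nbhd r I E (Suc n) \<subseteq> C" "C \<subseteq> nbhd r I E n"
      using nbhd_closed_between[OF E(1,2), of r I n] by (elim exE conjE)
    then show ?thesis
      using E by (intro exI[of _ "nbhd r I E (Suc n)"] exI[of _ C]) (simp add: openin_nbhd)
  qed
  ultimately have "perfectly_normal_space (ftree r I J)"
    using perfectly_normal_if_metrizable_off_point[OF t1_ftree _ _ metrizable_ftree_off_apex, of r I J]
    by simp
  then show ?thesis
    unfolding almost_metrizable_space_def
    using metrizable_ftree_off_apex[of r I J] by (metis apex_in_tree topspace_ftree)
qed

section \<open>Arcs to the root, path connectedness and local path connectedness\<close>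

definition ancestors :: "'a rel \<Rightarrow> 'a point \<Rightarrow> 'a point set" where
  "ancestors r x = {y \<in> tree r. \<forall>u. height y u \<le> height x u}"

text \<open>\<open>ancestors r x\<close> is the arc from the root to \<open>x\<close>. One
  coordinate decides membership: apart from \<open>fst y\<close>, the nonzero coordinates of
  \<open>y\<close> sit at proper suffixes of \<open>fst y\<close>, and these have coordinate 1 at
  \<open>x\<close> as soon as \<open>fst y\<close> is a suffix of \<open>fst x\<close>.\<close>

lemma in_ancestors_iff:
  assumes x: "x \<in> tree r" and y: "y \<in> tree r"
  shows "y \<in> ancestors r x \<longleftrightarrow> snd y \<le> height x (fst y)"
proof
  show "snd y \<le> height x (fst y)" if "y \<in> ancestors r x"
    using that by (auto simp: ancestors_def height_def dest: spec[of _ "fst y"])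
  assume *: "snd y \<le> height x (fst y)"
  moreover have "0 < snd y"
    using y by (auto simp: tree_def)
  ultimately have s: "suffix (fst y) (fst x)"
    using height_pos_iff[OF x, of "fst y"] by linarith
  have "height y u \<le> height x u" for u
  proof (cases "u = fst y")
    case True
    then show ?thesis using * by (simp add: height_def)
  next
    case False
    then show ?thesis
      using s height_bounds[OF x, of u]
      by (auto simp: height_def dest: suffix_order.trans suffix_order.antisym)
  qed
  then show "y \<in> ancestors r x"
    using y by (simp add: ancestors_def)
qed

lemma ancestors_refl: "x \<in> tree r \<Longrightarrow> x \<in> ancestors r x"
  by (simp add: ancestors_def)

lemma apex_in_ancestors: "x \<in> tree r \<Longrightarrow> apex \<in> ancestors r x"
  by (simp add: in_ancestors_iff) (simp add: apex_def height_Nil)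

lemma ancestors_apex: "ancestors r apex = {apex}"
proof -
  have "y = apex" if y: "y \<in> ancestors r apex" for y
  proof (rule ccontr)
    have yt: "y \<in> tree r"
      using y by (simp add: ancestors_def)
    assume "y \<noteq> apex"
    then obtain c where "0 < height y [c]"
      using tree_root yt by metis
    moreover have "height y [c] \<le> height apex [c]"
      using y by (simp add: ancestors_def)
    ultimately show False
      by (simp add: height_apex)
  qed
  then show ?thesis
    using apex_in_ancestors[of apex r] by auto
qed

lemma ancestors_Cons:
  assumes "c # s \<in> nodes r" "0 < t" "t \<le> 1"
  shows "ancestors r (c # s, t) = edge (c # s) ` {0..t} \<union> ancestors r (s, 1)"
proof -
  have x: "(c # s, t) \<in> tree r" "(s, 1) \<in> tree r"
    using assms by (auto simp: tree_iff nodes_Cons)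
  have 1: "height (c # s, t) u = (if u = c # s then t else if suffix u s then 1 else 0)" for u
    by (auto simp: height_def suffix_Cons)
  have 2: "height (s, 1) u = (if suffix u s then 1 else 0)" for u
    by (auto simp: height_def)
  have "y \<in> ancestors r (c # s, t) \<longleftrightarrow> y \<in> edge (c # s) ` {0..t} \<union> ancestors r (s, 1)" if y: "y \<in> tree r" for y
  proof -
    obtain u a where ua: "y = (u, a)" by fastforce
    have a: "0 < a" "a \<le> 1"
      using y ua by (auto simp: tree_iff)
    show ?thesis
    proof (cases "u = c # s")
      case True
      then have "y \<in> edge (c # s) ` {0..t} \<longleftrightarrow> a \<le> t"
        using a ua by (auto simp: edge_def image_iff split: if_splits)
      then show ?thesis
        using True unfolding Un_iff in_ancestors_iff[OF x(1) y] in_ancestors_iff[OF x(2) y]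
        using a by (simp add: ua 1 2)
    next
      case False
      have "y \<in> edge (c # s) ` {0..t} \<Longrightarrow> y = (s, 1)"
        using False ua by (auto simp: edge_def split: if_splits)
      then show ?thesis
        using False unfolding Un_iff in_ancestors_iff[OF x(1) y] in_ancestors_iff[OF x(2) y]
        using a by (auto simp: ua 1 2)
    qed
  qed
  moreover have "edge (c # s) ` {0..t} \<subseteq> tree r"
    using assms edge_in_tree[of "c # s" r] by auto
  ultimately show ?thesis
    by (auto simp: ancestors_def)
qed

text \<open>Off the root this follows because \<open>edge s\<close> is isometric for the tree
  distance. The root is met only at parameter 0 and only when \<open>s\<close> has length one; there
  the collar in each basic neighbourhood suffices.\<close>

lemma continuous_map_edge:
  assumes s: "s \<in> nodes r" "s \<noteq> []"
  shows "continuous_map (top_of_set {0..1}) (ftree r I J) (edge s)"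
  unfolding continuous_map_def
proof (intro conjI allI impI)
  show "edge s \<in> topspace (top_of_set {0..1}) \<rightarrow> topspace (ftree r I J)"
    using edge_in_tree[OF s] by auto
  fix U assume U: "openin (ftree r I J) U"
  have "\<exists>e>0. \<forall>b\<in>{0..1}. dist b a < e \<longrightarrow> edge s b \<in> U" if a: "a \<in> {0..1}" "edge s a \<in> U" for a
  proof (cases "edge s a = apex")
    case True
    then have "a = 0" and "tl s = []"
      using s(2) by (auto simp: edge_def apex_def split: if_splits)
    then obtain c where c: "s = [c]"
      using s(2) by (cases s) auto
    obtain E n where E: "nbhd r I E n \<subseteq> U"
      using U True a by (auto simp: openin_ftree)
    have "edge s b \<in> U" if b: "b \<in> {0..1}" "dist b a < inverse (Suc n)" for b
    proof -
      have "edge s b \<in> nbhd r I E n"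
      proof (cases "b = 0")
        case True
        then show ?thesis
          using c by (simp add: edge_def flip: apex_def)
      next
        case False
        then have "0 < height (edge s b) [c]" "height (edge s b) [c] < inverse (Suc n)"
          using b \<open>a = 0\<close> c by (auto simp: height_edge)
        then show ?thesis
          using edge_in_tree[OF s] b unfolding nbhd_def by fastforce
      qed
      then show ?thesis using E by blast
    qed
    then show ?thesis
      by (intro exI[of _ "inverse (Suc n)"]) auto
  next
    case False
    have "openin (tree_top r) (U - {apex})"
      using U by (simp add: openin_ftree)
    then obtain e where e: "e > 0" "tree.mball r (edge s a) e \<subseteq> U"
      using False a(2) unfolding tree.openin_mtopology by blast
    have "edge s b \<in> U" if "b \<in> {0..1}" "dist b a < e" for b
    proof -
      have "edge s b \<in> tree.mball r (edge s a) e"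
        using edge_in_tree[OF s] a that tdist_edge[OF s(2), of a b] by (auto simp: dist_real_def)
      then show ?thesis using e by blast
    qed
    then show ?thesis
      using e by blast
  qed
  then show "openin (top_of_set {0..1}) {x \<in> topspace (top_of_set {0..1}). edge s x \<in> U}"
    by (subst openin_euclidean_subtopology_iff) auto
qed

lemma path_connectedin_edge:
  assumes "s \<in> nodes r" "s \<noteq> []" "0 \<le> a" "b \<le> 1"
  shows "path_connectedin (ftree r I J) (edge s ` {a..b})"
proof (rule path_connectedin_continuous_map_image[OF continuous_map_edge[OF assms(1,2)]])
  show "path_connectedin (top_of_set {0..1}) {a..b}"
    using assms by (auto simp: path_connectedin_subtopology)
qed

lemma path_connectedin_ancestors:
  assumes "x \<in> tree r"
  shows "path_connectedin (ftree r I J) (ancestors r x)"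
proof -
  have "path_connectedin (ftree r I J) (ancestors r (s, t))" if "(s, t) \<in> tree r" for s t
    using that
  proof (induction s arbitrary: t)
    case Nil
    then have "([], t) = (apex :: 'a point)"
      by (auto simp: tree_iff apex_def)
    then show ?case
      by (simp add: ancestors_apex)
  next
    case (Cons c s)
    then have n: "c # s \<in> nodes r" "0 < t" "t \<le> 1"
      by (auto simp: tree_iff)
    then have s1: "(s, 1) \<in> tree r"
      by (simp add: nodes_Cons)
    have "edge (c # s) 0 \<in> edge (c # s) ` {0..t}"
      using n by (intro imageI) auto
    then have "(s, 1) \<in> edge (c # s) ` {0..t} \<inter> ancestors r (s, 1)"
      using ancestors_refl[OF s1] unfolding edge_Cons_0 by blast
    then show ?case
      unfolding ancestors_Cons[OF n]
      using path_connectedin_edge[OF n(1)] n Cons.IH[OF s1] by (intro path_connectedin_Un) auto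
  qed
  then show ?thesis
    using assms by (metis prod.collapse)
qed

lemma path_connected_ftree: "path_connected_space (ftree r I J)"
proof -
  have "path_connectedin (ftree r I J) (tree r)"
  proof (rule path_connectedin_star[where z = apex])
    fix y assume y: "y \<in> tree r"
    then show "\<exists>T. path_connectedin (ftree r I J) T \<and> T \<subseteq> tree r \<and> apex \<in> T \<and> y \<in> T"
      using path_connectedin_ancestors[OF y] apex_in_ancestors[OF y] ancestors_refl[OF y]
      by (intro exI[of _ "ancestors r y"]) (auto simp: ancestors_def)
  qed
  then show ?thesis
    by (metis path_connectedin_topspace topspace_ftree)
qed

text \<open>Passing to an ancestor lowers the coordinates and, short of the root, keeps the branch.
  So the arc from each point of the set to the root stays inside.\<close>

lemma path_connectedin_nbhd: "path_connectedin (ftree r I J) (nbhd r I E n)"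
proof (rule path_connectedin_star[where z = apex])
  fix y assume y: "y \<in> nbhd r I E n"
  then have yt: "y \<in> tree r"
    by (simp add: nbhd_def)
  have "z \<in> nbhd r I E n" if z: "z \<in> ancestors r y" for z
  proof (cases "z = apex")
    case False
    have zt: "z \<in> tree r" and le: "\<And>u. height z u \<le> height y u"
      using z by (auto simp: ancestors_def)
    obtain c where c: "0 < height z [c]"
      using tree_root[OF zt False] by metis
    then have "height z [c] < inverse (Suc n) \<or> fst c \<in> (\<Inter>i\<in>E. I i) \<and> n \<le> snd c"
      using nbhd_subset_root[OF y, of c] le[of "[c]"] by auto
    then show ?thesis
      using c zt by (auto simp: nbhd_def)
  qed simp
  then show "\<exists>T. path_connectedin (ftree r I J) T \<and> T \<subseteq> nbhd r I E n \<and> apex \<in> T \<and> y \<in> T"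
    using path_connectedin_ancestors[OF yt] apex_in_ancestors[OF yt] ancestors_refl[OF yt] by blast
qed

text \<open>By \<open>mball_cases\<close> the ball reaches along the segment of \<open>s\<close> and
  possibly into lower pieces of child segments. Each of its points is joined to the centre along at
  most two segments.\<close>

lemma path_connectedin_mball:
  assumes x: "(s, t) \<in> tree r" and s: "s \<noteq> []" and e: "0 < e" "e \<le> t"
  shows "path_connectedin (ftree r I J) (tree.mball r (s, t) e)"
proof (rule path_connectedin_star[where z = "(s, t)"])
  have sn: "s \<in> nodes r" and t: "0 < t" "t \<le> 1"
    using x by (auto simp: tree_iff)
  have sub: "edge s ` {a..b} \<subseteq> tree.mball r (s, t) e" if "t - e < a" "b < t + e" "b \<le> 1" for a b
  proof
    fix y assume "y \<in> edge s ` {a..b}"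
    then obtain t' where t': "y = edge s t'" "a \<le> t'" "t' \<le> b"
      by auto
    moreover have "edge s t' \<in> tree r"
      using edge_in_tree[OF sn s] t' that e by auto
    ultimately show "y \<in> tree.mball r (s, t) e"
      using x tdist_edge[OF s, of t t'] that t by (auto simp: edge_pos)
  qed
  fix y assume y: "y \<in> tree.mball r (s, t) e"
  show "\<exists>T. path_connectedin (ftree r I J) T \<and> T \<subseteq> tree.mball r (s, t) e \<and> (s, t) \<in> T \<and> y \<in> T"
  proof (rule mball_cases[OF x e y])
    fix t' assume t': "y = (s, t')" "0 < t'" "t' \<le> 1" "\<bar>t' - t\<bar> < e"
    have "edge s ` {min t t'..max t t'} \<subseteq> tree.mball r (s, t) e"
      using t' e t by (intro sub) auto
    moreover have "(s, t) \<in> edge s ` {min t t'..max t t'}" "y \<in> edge s ` {min t t'..max t t'}"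
      using t' t by (auto simp: image_iff edge_def)
    ultimately show ?thesis
      using path_connectedin_edge[OF sn s, of "min t t'" "max t t'"] t t' by (metis less_eq_real_def max.bounded_iff min_def)
  next
    fix c t' assume t': "y = (c # s, t')" "c # s \<in> nodes r" "0 < t'" "t' < e" "1 - t < e"
    let ?A = "edge s ` {t..1}" and ?B = "edge (c # s) ` {0..t'}"
    have "?A \<subseteq> tree.mball r (s, t) e"
      using t' e t by (intro sub) auto
    moreover have "?B \<subseteq> tree.mball r (s, t) e"
    proof
      fix z assume "z \<in> ?B"
      then obtain b where b: "z = edge (c # s) b" "0 \<le> b" "b \<le> t'"
        by auto
      \<comment> \<open>The two legs of the path change different coordinates, so the sup distance
        is bounded by the larger leg and not by their sum.\<close>
      have "tdist (s, t) z \<le> max (1 - t) b"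
      proof (rule tdist_le)
        fix u
        have "height (s, t) u = (if u = s then t else if suffix u s then 1 else 0)"
          by (simp add: height_def)
        moreover have "height z u = (if u = c # s then b else if suffix u (c # s) then 1 else 0)"
          unfolding b(1) by (rule height_edge) simp
        ultimately show "\<bar>height (s, t) u - height z u\<bar> \<le> max (1 - t) b"
          using t b t' by (auto simp: suffix_Cons)
      qed
      moreover have "z \<in> tree r"
        using edge_in_tree[OF t'(2)] b t' e t by auto
      ultimately show "z \<in> tree.mball r (s, t) e"
        using x b t' by auto
    qed
    moreover have "path_connectedin (ftree r I J) (?A \<union> ?B)"
    proof (rule path_connectedin_Un)
      show "path_connectedin (ftree r I J) ?A" "path_connectedin (ftree r I J) ?B"
        using path_connectedin_edge[OF sn s, of t 1] path_connectedin_edge[OF t'(2), of 0 t'] t t' e by auto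
      have "(s, 1) \<in> ?A \<inter> ?B"
        using t t' by (auto simp: image_iff edge_def intro: bexI[of _ 1] bexI[of _ 0])
      then show "?A \<inter> ?B \<noteq> {}" by blast
    qed
    moreover have "(s, t) \<in> ?A" "y \<in> ?B"
      using t t' by (auto simp: image_iff edge_def)
    ultimately show ?thesis
      by (intro exI[of _ "?A \<union> ?B"]) auto
  qed
qed

lemma locally_path_connected_ftree: "locally_path_connected_space (ftree r I J)"
  unfolding locally_path_connected_space
proof (intro allI impI, elim conjE)
  fix V x assume V: "openin (ftree r I J) V" and x: "x \<in> V"
  show "\<exists>U. openin (ftree r I J) U \<and> path_connectedin (ftree r I J) U \<and> x \<in> U \<and> U \<subseteq> V"
  proof (cases "x = apex")
    case True
    then obtain E n where "finite E" "E \<subseteq> J" "nbhd r I E n \<subseteq> V"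
      using V x by (auto simp: openin_ftree)
    then show ?thesis
      using openin_nbhd path_connectedin_nbhd True by (metis apex_in_nbhd)
  next
    case False
    have xt: "x \<in> tree r"
      using V x by (auto simp: openin_ftree)
    obtain s t where st: "x = (s, t)" by fastforce
    have "s \<noteq> []" "0 < t"
      using xt st False by (auto simp: tree_iff apex_def)
    have "openin (tree_top r) (V - {apex})"
      using V by (simp add: openin_ftree)
    then obtain e where e: "e > 0" "tree.mball r x e \<subseteq> V - {apex}"
      using False x unfolding tree.openin_mtopology by blast
    \<comment> \<open>Cutting the radius at \<open>t\<close> makes
      \<open>path_connectedin_mball\<close> applicable.\<close>
    let ?B = "tree.mball r x (min e t)"
    have sub: "?B \<subseteq> V - {apex}"
      using e(2) tree.mball_subset_concentric[of "min e t" e r x] by (meson min.cobounded1 order_trans)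
    then have "apex \<notin> ?B"
      by blast
    then have "openin (ftree r I J) ?B"
      using openin_ftree_off_apex tree.openin_mball by blast
    moreover have "path_connectedin (ftree r I J) ?B"
      unfolding st using xt st \<open>s \<noteq> []\<close> \<open>0 < t\<close> e by (intro path_connectedin_mball) auto
    moreover have "x \<in> ?B"
      using xt e \<open>0 < t\<close> by auto
    ultimately show ?thesis
      using sub by blast
  qed
qed

subsection \<open>The tree order as a topological invariant\<close>

lemma height_antimono:
  assumes x: "x \<in> tree r" and uv: "suffix u v"
  shows "height x v \<le> height x u"
proof (cases "0 < height x v \<and> u \<noteq> v")
  case True
  then have "suffix v (fst x)"
    using height_pos_iff[OF x] by blast
  then have "suffix u (fst x)" "u \<noteq> fst x"
    using uv True suffix_order.trans suffix_order.antisym by blast+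
  then have "height x u = 1"
    by (simp add: height_def)
  then show ?thesis
    using height_bounds[OF x, of v] by simp
next
  case False
  then show ?thesis
    using height_bounds[OF x, of u] by force
qed

text \<open>Off the root this is the open condition that the coordinate \<open>fst y\<close> be less
  than \<open>snd y\<close>. At the root, \<open>eventually_not_nbhd\<close> bounds the coordinate
  \<open>[c]\<close> of the branch of \<open>y\<close>, and the coordinate \<open>fst y\<close> is
  no larger.\<close>

lemma openin_not_below:
  assumes y: "y \<in> tree r" "y \<noteq> apex"
  shows "openin (ftree r I J) {z \<in> tree r. y \<notin> ancestors r z}"
proof -
  obtain c where c: "suffix [c] (fst y)"
    using tree_root[OF y] by metis
  have pos: "0 < snd y"
    using y(1) by (auto simp: tree_def)
  have eq: "{z \<in> tree r. y \<notin> ancestors r z} = {z \<in> tree r. height z (fst y) \<in> {..<snd y}}"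
    using in_ancestors_iff[OF _ y(1)] by auto
  obtain n where n: "\<And>x E. x \<in> nbhd r I E (Suc n) \<Longrightarrow> height x [c] < snd y"
    using eventually_not_nbhd[OF pos] by metis
  have "nbhd r I {} (Suc n) \<subseteq> {z \<in> tree r. height z (fst y) \<in> {..<snd y}}"
  proof
    fix x assume x: "x \<in> nbhd r I {} (Suc n)"
    then have "x \<in> tree r"
      by (simp add: nbhd_def)
    then show "x \<in> {z \<in> tree r. height z (fst y) \<in> {..<snd y}}"
      using height_antimono[OF _ c] n[OF x] by fastforce
  qed
  moreover have "openin (tree_top r) ({z \<in> tree r. height z (fst y) \<in> {..<snd y}} - {apex})"
    using openin_height[of "{..<snd y}" r "fst y"] tree.t1_space_mtopology[of r]
    unfolding t1_space_openin_delete_alt by simp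
  ultimately show ?thesis
    unfolding eq openin_ftree by (intro conjI impI exI[of _ "{}"] exI[of _ "Suc n"]) auto
qed

text \<open>With \<open>y = (s, t)\<close>, points strictly beyond \<open>y\<close> either have
  coordinate \<open>s\<close> above \<open>t\<close> or have passed the node \<open>s\<close>. The
  latter are detected by a positive coordinate at a child, since the coordinate \<open>s\<close>
  never exceeds 1.\<close>

lemma openin_strictly_below:
  assumes y: "y \<in> tree r" "y \<noteq> apex"
  shows "openin (ftree r I J) {z \<in> tree r. y \<in> ancestors r z \<and> z \<noteq> y}"
proof -
  obtain s t where st: "y = (s, t)" by fastforce
  have t: "0 < t" "t \<le> 1" and s: "s \<noteq> []"
    using y st by (auto simp: tree_iff apex_def)
  have "y \<in> ancestors r z \<and> z \<noteq> y \<longleftrightarrow> t < height z s \<or> (\<exists>c. 0 < height z (c # s))" if z: "z \<in> tree r" for z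
  proof
    assume *: "y \<in> ancestors r z \<and> z \<noteq> y"
    then have le: "t \<le> height z s"
      using in_ancestors_iff[OF z y(1)] st by simp
    then have "suffix s (fst z)"
      using height_pos_iff[OF z, of s] t by simp
    then obtain p where p: "fst z = p @ s"
      by (auto simp: suffix_def)
    show "t < height z s \<or> (\<exists>c. 0 < height z (c # s))"
    proof (cases p rule: rev_cases)
      case Nil
      then have "height z s = snd z" "snd z \<noteq> t"
        using p * st by (auto simp: height_def prod_eq_iff)
      then show ?thesis using le by simp
    next
      case (snoc q c)
      then have "suffix (c # s) (fst z)"
        using p by (simp add: suffix_def)
      then show ?thesis
        using height_pos_iff[OF z] by blast
    qed
  next
    assume *: "t < height z s \<or> (\<exists>c. 0 < height z (c # s))"
    then show "y \<in> ancestors r z \<and> z \<noteq> y"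
    proof
      assume "t < height z s"
      then show ?thesis
        using in_ancestors_iff[OF z y(1)] st by (auto simp: height_def)
    next
      assume "\<exists>c. 0 < height z (c # s)"
      then obtain c where c: "suffix (c # s) (fst z)"
        using height_pos_iff[OF z] by blast
      then have "suffix s (fst z)" "s \<noteq> fst z"
        using suffix_ConsD[OF c] by auto
      then have "height z s = 1"
        by (simp add: height_def)
      then show ?thesis
        using in_ancestors_iff[OF z y(1)] st t \<open>s \<noteq> fst z\<close> by auto
    qed
  qed
  then have eq: "{z \<in> tree r. y \<in> ancestors r z \<and> z \<noteq> y} =
      {z \<in> tree r. height z s \<in> {t<..}} \<union> (\<Union>c. {z \<in> tree r. height z (c # s) \<in> {0<..}})"
    by auto
  have o: "openin (tree_top r) {z \<in> tree r. height z u \<in> {a<..}}" for u a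
    by (rule openin_height) simp
  have "openin (tree_top r) {z \<in> tree r. y \<in> ancestors r z \<and> z \<noteq> y}"
    unfolding eq by (intro openin_Un openin_clauses(3) o) (use o in blast)
  moreover have "apex \<notin> {z \<in> tree r. y \<in> ancestors r z \<and> z \<noteq> y}"
    using y by (simp add: ancestors_apex)
  ultimately show ?thesis
    using openin_ftree_off_apex[of _ r I J] by simp
qed

text \<open>If \<open>y\<close> is on the arc, a set missing \<open>y\<close> is split by the two
  open sets of \<open>openin_not_below\<close> and \<open>openin_strictly_below\<close>, one holding
  the root and the other \<open>x\<close>. Conversely, the arc itself is a connected set to test
  with.\<close>

lemma in_ancestors_iff_connected:
  assumes x: "x \<in> tree r" and y: "y \<in> tree r"
  shows "y \<in> ancestors r x \<longleftrightarrow> (\<forall>T. connectedin (ftree r I J) T \<longrightarrow> x \<in> T \<longrightarrow> apex \<in> T \<longrightarrow> y \<in> T)"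
proof
  assume *: "y \<in> ancestors r x"
  show "\<forall>T. connectedin (ftree r I J) T \<longrightarrow> x \<in> T \<longrightarrow> apex \<in> T \<longrightarrow> y \<in> T"
  proof (intro allI impI, rule ccontr)
    fix T assume T: "connectedin (ftree r I J) T" "x \<in> T" "apex \<in> T" "y \<notin> T"
    then have ya: "y \<noteq> apex" "x \<noteq> y"
      by auto
    let ?A = "{z \<in> tree r. y \<notin> ancestors r z}" and ?B = "{z \<in> tree r. y \<in> ancestors r z \<and> z \<noteq> y}"
    have "T \<subseteq> tree r"
      using T(1) connectedin_subset_topspace by fastforce
    moreover have "openin (ftree r I J) ?A" "openin (ftree r I J) ?B"
      using openin_not_below[OF y ya(1)] openin_strictly_below[OF y ya(1)] by auto
    moreover have "T \<subseteq> ?A \<union> ?B" "?A \<inter> ?B \<inter> T = {}"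
      using T \<open>T \<subseteq> tree r\<close> by auto
    moreover have "apex \<in> ?A \<inter> T" "x \<in> ?B \<inter> T"
      using T ya x * by (auto simp: ancestors_apex)
    ultimately show False
      using T(1) unfolding connectedin by blast
  qed
next
  assume "\<forall>T. connectedin (ftree r I J) T \<longrightarrow> x \<in> T \<longrightarrow> apex \<in> T \<longrightarrow> y \<in> T"
  then show "y \<in> ancestors r x"
    using path_connectedin_imp_connectedin[OF path_connectedin_ancestors[OF x]] ancestors_refl[OF x] apex_in_ancestors[OF x] by blast
qed

subsection \<open>Rigidity\<close>

text \<open>The label of the segment carrying \<open>x\<close>. At the root \<open>hd []\<close> is
  unspecified, so the root is excluded where labels are compared.\<close>

definition label :: "'a point \<Rightarrow> 'a" where
  "label x = fst (hd (fst x))"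

text \<open>Only the tree order is mentioned, so homeomorphisms between spaces with different index
  sets \<open>J\<close> and \<open>J'\<close> are covered as well.\<close>

definition tree_auto :: "'a rel \<Rightarrow> ('a point \<Rightarrow> 'a point) \<Rightarrow> bool" where
  "tree_auto r h \<longleftrightarrow> bij_betw h (tree r) (tree r) \<and> h apex = apex \<and>
     (\<forall>x\<in>tree r. \<forall>y\<in>tree r. h y \<in> ancestors r (h x) \<longleftrightarrow> y \<in> ancestors r x)"

lemma tree_auto_inv:
  assumes "tree_auto r h"
  shows "tree_auto r (inv_into (tree r) h)"
proof -
  let ?g = "inv_into (tree r) h"
  have b: "bij_betw h (tree r) (tree r)" and a: "h apex = apex"
    and i: "\<And>x y. x \<in> tree r \<Longrightarrow> y \<in> tree r \<Longrightarrow> h y \<in> ancestors r (h x) \<longleftrightarrow> y \<in> ancestors r x"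
    using assms by (auto simp: tree_auto_def)
  have g: "?g x \<in> tree r" "h (?g x) = x" if "x \<in> tree r" for x
    using b that by (auto simp: bij_betw_def inv_into_into f_inv_into_f)
  have "?g apex = apex"
    using b a by (metis apex_in_tree bij_betw_inv_into_left)
  moreover have "?g y \<in> ancestors r (?g x) \<longleftrightarrow> y \<in> ancestors r x" if "x \<in> tree r" "y \<in> tree r" for x y
    using i[OF g(1)[OF that(1)] g(1)[OF that(2)]] g(2) that by simp
  ultimately show ?thesis
    using bij_betw_inv_into[OF b] by (simp add: tree_auto_def)
qed

lemma ancestors_suffix:
  assumes x: "x \<in> tree r" and y: "y \<in> ancestors r x"
  shows "suffix (fst y) (fst x)"
proof -
  have yt: "y \<in> tree r"
    using y by (simp add: ancestors_def)
  then have "0 < snd y"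
    by (auto simp: tree_def)
  then have "0 < height x (fst y)"
    using y in_ancestors_iff[OF x yt] by simp
  then show ?thesis
    using height_pos_iff[OF x] by blast
qed

text \<open>Entries of a node decrease towards the head, so labels drop whenever a node is passed on
  the way from the root.\<close>

lemma label_below:
  assumes v: "v \<in> tree r" and x: "x \<in> ancestors r v" "x \<noteq> apex" and ne: "fst v \<noteq> fst x"
  shows "(label v, label x) \<in> r - Id"
proof -
  have xt: "x \<in> tree r"
    using x by (simp add: ancestors_def)
  have fx: "fst x \<noteq> []"
    using xt x(2) tree_apex_iff[of "fst x" "snd x" r] by simp
  obtain p where p: "fst v = p @ fst x"
    using ancestors_suffix[OF v x(1)] by (auto simp: suffix_def)
  then obtain c q where c: "p = c # q"
    using ne by (cases p) auto
  have "fst v \<in> nodes r"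
    using v tree_iff[of "fst v" "snd v"] by simp
  then have "(fst c, fst (hd (fst x))) \<in> r - Id"
    using fx unfolding p c by (simp add: nodes_Cons)
  then show ?thesis
    by (simp add: label_def p c)
qed

lemma label_Field: "x \<in> tree r \<Longrightarrow> x \<noteq> apex \<Longrightarrow> label x \<in> Field r"
  by (cases x; cases "fst x") (auto simp: tree_iff nodes_Cons label_def apex_def)

text \<open>Well-founded induction on the label. The map \<open>h\<close> is generalised because one
  case applies the induction hypothesis to its inverse.\<close>

lemma tree_auto_label:
  assumes wo: "Well_order r" and h: "tree_auto r h" and x: "x \<in> tree r" "x \<noteq> apex"
  shows "label (h x) = label x"
proof -
  have "wf (r - Id)"
    using wo by (simp add: well_order_on_def)
  have tr: "trans r"
    using wo by (simp add: order_on_defs)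
  then show ?thesis
    using h x
  proof (induction "label x" arbitrary: x h rule: wf_induct_rule[OF \<open>wf (r - Id)\<close>])
    case (1 x h)
    note h = \<open>tree_auto r h\<close> and x = \<open>x \<in> tree r\<close> \<open>x \<noteq> apex\<close>
    let ?g = "inv_into (tree r) h"
    have b: "bij_betw h (tree r) (tree r)" and a: "h apex = apex"
      and i: "\<And>x y. x \<in> tree r \<Longrightarrow> y \<in> tree r \<Longrightarrow> h y \<in> ancestors r (h x) \<longleftrightarrow> y \<in> ancestors r x"
      using h by (auto simp: tree_auto_def)
    have IH: "label (f v) = label v"
      if "(label v, label x) \<in> r - Id" "tree_auto r f" "v \<in> tree r" "v \<noteq> apex" for v f
      using 1(1)[OF that(1) tr that(2-4)] .
    have hx: "h x \<in> tree r" "h x \<noteq> apex"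
      using b a x by (auto simp: bij_betw_def dest: inj_onD[of h "tree r" x apex])
    show ?case
    proof (rule ccontr)
      assume ne: "label (h x) \<noteq> label x"
      have "(label (h x), label x) \<in> r - Id \<or> (label x, label (h x)) \<in> r - Id"
        using wo label_Field[OF x] label_Field[OF hx] ne
        by (auto simp: order_on_defs total_on_def)
      then show False
      proof
        \<comment> \<open>A dropped label is impossible because the inverse preserves the smaller
          label of \<open>h x\<close>.\<close>
        assume "(label (h x), label x) \<in> r - Id"
        then have "label (?g (h x)) = label (h x)"
          using IH tree_auto_inv[OF h] hx by blast
        then show False
          using ne bij_betw_inv_into_left[OF b x(1)] by simp
      next
        assume lt: "(label x, label (h x)) \<in> r - Id"
        obtain s t where st: "h x = (s, t)" by fastforce
        have sn: "s \<in> nodes r" "s \<noteq> []"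
          using hx st by (auto simp: tree_iff apex_def)
        \<comment> \<open>In the case of a raised label, \<open>label x\<close> is below every label
          in \<open>s\<close>, so the node \<open>s\<close> has children with this label in every
          copy.\<close>
        define u where "u k = (((label x, k) # s, 1) :: 'a point)" for k :: nat
        have less: "(label x, fst c) \<in> r - Id" if "c \<in> set s" for c
        proof -
          obtain d s' where s': "s = d # s'"
            using sn by (cases s) auto
          have d: "label (h x) = fst d"
            using st s' by (simp add: label_def)
          show ?thesis
          proof (cases "c = d")
            case False
            then have "(fst d, fst c) \<in> r - Id"
              using sn that s' by (auto simp: nodes_Cons)
            then show ?thesis
              using lt d tr wo by (auto simp: order_on_defs trans_def antisym_def)
          qed (use lt d in simp)
        qed
        have ut: "u k \<in> tree r" for k
          using less label_Field[OF x] sn unfolding u_def by (auto simp: tree_iff nodes_Cons)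
        define v where "v k = ?g (u k)" for k
        have vt: "v k \<in> tree r" "h (v k) = u k" for k
          using b ut[of k] by (auto simp: v_def bij_betw_def inv_into_into f_inv_into_f)
        have "h x \<in> ancestors r (u k)" for k
          using in_ancestors_iff[OF ut hx(1), of k] hx st by (auto simp: u_def height_def tree_iff suffix_Cons)
        then have xv: "x \<in> ancestors r (v k)" for k
          using i[OF vt(1) x(1), of k] vt(2) by simp
        have vna: "v k \<noteq> apex" for k
          using xv[of k] x(2) by (auto simp: ancestors_apex)
        have lu: "label (u k) = label x" for k
          by (simp add: u_def label_def)
        \<comment> \<open>Were \<open>v k\<close> off the segment of \<open>x\<close>, its label
          would be smaller than \<open>label x\<close> and preserved by \<open>h\<close>, but
          \<open>u k\<close> has label \<open>label x\<close>.\<close>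
        have "fst (v k) = fst x" for k
        proof (rule ccontr)
          assume "fst (v k) \<noteq> fst x"
          then have l: "(label (v k), label x) \<in> r - Id"
            using label_below[OF vt(1) xv x(2)] by blast
          then have "label (h (v k)) = label (v k)"
            using IH[OF l h vt(1) vna] by simp
          then show False
            using l vt(2) lu by simp
        qed
        \<comment> \<open>Points on one segment are comparable, whereas the two copies
          \<open>u 0\<close> and \<open>u 1\<close> are not.\<close>
        then have "v 0 \<in> ancestors r (v 1) \<or> v 1 \<in> ancestors r (v 0)"
          using in_ancestors_iff[OF vt(1) vt(1)] by (auto simp: height_def)
        then have "u 0 \<in> ancestors r (u 1) \<or> u 1 \<in> ancestors r (u 0)"
          using i[OF vt(1) vt(1)] vt(2) by metis
        then have "suffix (fst (u 0)) (fst (u 1)) \<or> suffix (fst (u 1)) (fst (u 0))"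
          using ancestors_suffix[OF ut] by blast
        then show False
          by (auto simp: u_def suffix_Cons)
      qed
    qed
  qed
qed

text \<open>By \<open>in_ancestors_iff_connected\<close> the order is expressed through connected
  sets and the root, and \<open>h\<close> respects both.\<close>

lemma homeomorphic_map_tree_auto:
  assumes h: "homeomorphic_map (ftree r I J) (ftree r I' J') h" and a: "h apex = apex"
  shows "tree_auto r h"
proof -
  have b: "bij_betw h (tree r) (tree r)"
    using h by (simp add: homeomorphic_eq_everything_map bij_betw_def)
  have "h y \<in> ancestors r (h x) \<longleftrightarrow> y \<in> ancestors r x" if xy: "x \<in> tree r" "y \<in> tree r" for x y
  proof -
    have hxy: "h x \<in> tree r" "h y \<in> tree r"
      using b xy by (auto simp: bij_betw_def)
    have inj: "z \<in> T" if "h z \<in> h ` T" "z \<in> tree r" "T \<subseteq> tree r" for z T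
      using b that by (auto simp: bij_betw_def inj_on_def)
    show ?thesis
      unfolding in_ancestors_iff_connected[OF hxy, of I' J'] in_ancestors_iff_connected[OF xy, of I J]
    proof (intro iffI allI impI)
      fix T assume *: "\<forall>T. connectedin (ftree r I' J') T \<longrightarrow> h x \<in> T \<longrightarrow> apex \<in> T \<longrightarrow> h y \<in> T"
        and T: "connectedin (ftree r I J) T" "x \<in> T" "apex \<in> T"
      have Tt: "T \<subseteq> tree r"
        using connectedin_subset_topspace[OF T(1)] by simp
      have "connectedin (ftree r I' J') (h ` T)"
        using connectedin_continuous_map_image[OF homeomorphic_imp_continuous_map[OF h] T(1)] .
      moreover have "h x \<in> h ` T" "apex \<in> h ` T"
        using T(2) imageI[OF T(3), of h] a by auto
      ultimately have "h y \<in> h ` T"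
        using * by blast
      then show "y \<in> T"
        using inj xy(2) Tt by blast
    next
      fix T assume *: "\<forall>T. connectedin (ftree r I J) T \<longrightarrow> x \<in> T \<longrightarrow> apex \<in> T \<longrightarrow> y \<in> T"
        and T: "connectedin (ftree r I' J') T" "h x \<in> T" "apex \<in> T"
      let ?T = "{z \<in> tree r. h z \<in> T}"
      have Tt: "T \<subseteq> tree r"
        using connectedin_subset_topspace[OF T(1)] by simp
      have "h ` ?T = T"
        using homeomorphic_map_image_preimage[OF h, of T] Tt by simp
      then have "connectedin (ftree r I J) ?T"
        using homeomorphic_map_connectedness[OF h, of ?T] T(1) by auto
      then show "h y \<in> T"
        using * xy T a by force
    qed
  qed
  then show ?thesis
    using a b by (simp add: tree_auto_def)
qed

section \<open>Recovering the index set from the topology\<close>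

text \<open>Equivalently, on \<open>S\<close> no member of the family belongs to the filter
  generated by the other members.\<close>

definition indep :: "'a set \<Rightarrow> 'i set \<Rightarrow> ('i \<Rightarrow> 'a set) \<Rightarrow> bool" where
  "indep S A I \<longleftrightarrow> (\<forall>E i. finite E \<longrightarrow> E \<subseteq> A \<longrightarrow> i \<in> A - E \<longrightarrow> (\<exists>a\<in>S. a \<in> (\<Inter>j\<in>E. I j) \<and> a \<notin> I i))"

lemma indepD:
  assumes "indep S A I" "finite E" "E \<subseteq> A" "i \<in> A" "i \<notin> E"
  obtains a where "a \<in> S" "a \<in> (\<Inter>j\<in>E. I j)" "a \<notin> I i"
  using assms unfolding indep_def by blast

text \<open>For \<open>i\<close> in \<open>J\<close> but not in \<open>J'\<close>, the image of
  \<open>nbhd r I {i} 0\<close> contains some \<open>nbhd r I E n\<close> with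
  \<open>E \<subseteq> J'\<close>. Independence gives a label \<alpha> in all sets of
  \<open>E\<close> but outside \<open>I i\<close>; the branch \<open>(\<alpha>, n)\<close> lies in
  the image, and label preservation contradicts this.\<close>

lemma homeomorphic_map_index_subset:
  assumes wo: "Well_order r" and ind: "indep (Field r) A I" and JA: "J \<subseteq> A" "J' \<subseteq> A"
    and h: "homeomorphic_map (ftree r I J) (ftree r I J') h" and a: "h apex = apex"
  shows "J \<subseteq> J'"
proof
  fix i assume i: "i \<in> J"
  show "i \<in> J'"
  proof (rule ccontr)
    assume iJ': "i \<notin> J'"
    have ha: "tree_auto r h"
      using homeomorphic_map_tree_auto[OF h a] .
    then have b: "bij_betw h (tree r) (tree r)"
      and le: "\<And>x y. x \<in> tree r \<Longrightarrow> y \<in> tree r \<Longrightarrow> h y \<in> ancestors r (h x) \<longleftrightarrow> y \<in> ancestors r x"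
      by (auto simp: tree_auto_def)
    have napex: "h z \<noteq> apex" if "z \<in> tree r" "z \<noteq> apex" for z
      using b a that apex_in_tree[of r] unfolding bij_betw_def inj_on_def by metis
    have "openin (ftree r I J) (nbhd r I {i} 0)"
      using i by (intro openin_nbhd) auto
    then have "openin (ftree r I J') (h ` nbhd r I {i} 0)"
      using homeomorphic_imp_open_map[OF h] by (simp add: open_map_def)
    moreover have "apex \<in> h ` nbhd r I {i} 0"
      using a apex_in_nbhd by (metis imageI)
    ultimately obtain E n where E: "finite E" "E \<subseteq> J'" "nbhd r I E n \<subseteq> h ` nbhd r I {i} 0"
      by (rule openin_ftree_nbhd)
    obtain \<alpha> where \<alpha>: "\<alpha> \<in> Field r" "\<alpha> \<in> (\<Inter>j\<in>E. I j)" "\<alpha> \<notin> I i"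
      using indepD[OF ind E(1), of i] E(2) JA i iJ' by blast
    \<comment> \<open>Copy number \<open>n\<close> makes the branch through \<open>y\<close> one of
      those taken entire in \<open>nbhd r I E n\<close>.\<close>
    define y where "y = ([(\<alpha>, n)], 1 :: real)"
    have y: "y \<in> tree r" "y \<noteq> apex"
      using \<alpha> by (auto simp: y_def tree_iff apex_def)
    obtain x where x: "x \<in> tree r" "h x = y"
      using b y(1) by (metis bij_betw_imp_surj_on imageE)
    have xa: "x \<noteq> apex"
      using x y a by auto
    have lx: "label x = \<alpha>"
      using tree_auto_label[OF wo ha x(1) xa] x(2) by (simp add: y_def label_def)
    have "fst x \<noteq> []"
      using x(1) xa tree_apex_iff[of "fst x" "snd x" r] by simp
    then obtain c s t where xs: "x = (c # s, t)"
      by (cases x; cases "fst x") auto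
    have cn: "c # s \<in> nodes r" "0 < t" "t \<le> 1"
      using x xs by (auto simp: tree_iff)
    \<comment> \<open>Otherwise the parent \<open>z\<close> of \<open>x\<close> has a label above
      \<alpha>, yet \<open>h z\<close> lies on the arc to \<open>y\<close>, where every point but
      the root has label \<alpha>.\<close>
    have "s = []"
    proof (rule ccontr)
      assume s: "s \<noteq> []"
      define z where "z = (s, 1 :: real)"
      have z: "z \<in> tree r" "z \<noteq> apex"
        using cn s by (auto simp: z_def tree_iff apex_def nodes_Cons)
      have zx: "z \<in> ancestors r x"
        using in_ancestors_iff[OF x(1) z(1)] by (simp add: z_def xs height_def suffix_Cons)
      have l: "(\<alpha>, label z) \<in> r - Id"
        using label_below[OF x(1) zx z(2)] lx by (simp add: xs z_def)
      have "h z \<in> ancestors r y"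
        using le[OF x(1) z(1)] x(2) zx by simp
      moreover have "h z \<in> tree r"
        using b z by (auto simp: bij_betw_def)
      ultimately have "suffix (fst (h z)) [(\<alpha>, n)]" "fst (h z) \<noteq> []"
        using ancestors_suffix[OF y(1), of "h z"] napex[OF z] tree_apex_iff[of "fst (h z)" "snd (h z)" r]
        by (simp_all add: y_def)
      then have "fst (h z) = [(\<alpha>, n)]"
        by (simp add: suffix_Cons)
      then have "label (h z) = \<alpha>"
        by (simp add: label_def)
      then show False
        using l tree_auto_label[OF wo ha z] by simp
    qed
    \<comment> \<open>The point \<open>x\<close> itself could lie in the collar of
      \<open>nbhd r I {i} 0\<close>, which consists of heights below 1. The node at height 1 belongs
      to that set only if its entire branch does.\<close>
    define z where "z = ([c], 1 :: real)"
    have z: "z \<in> tree r"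
      using cn by (simp add: z_def nodes_Cons)
    have "x \<in> ancestors r z"
      using in_ancestors_iff[OF z x(1)] cn by (simp add: z_def xs \<open>s = []\<close> height_def)
    then have "y \<in> ancestors r (h z)"
      using le[OF z x(1)] x(2) by simp
    moreover have hz: "h z \<in> tree r"
      using b z by (auto simp: bij_betw_def)
    ultimately have "0 < height (h z) [(\<alpha>, n)]"
      using in_ancestors_iff[OF hz y(1)] by (simp add: y_def)
    then have "h z \<in> nbhd r I E n"
      unfolding nbhd_def using hz \<alpha>(2) by (intro CollectI conjI disjI2 exI[of _ "(\<alpha>, n)"]) auto
    then obtain w where w: "w \<in> nbhd r I {i} 0" "h z = h w"
      using E(3) by blast
    moreover have "w \<in> tree r"
      using w by (simp add: nbhd_def)
    ultimately have "z \<in> nbhd r I {i} 0"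
      using b z by (metis bij_betw_imp_inj_on inj_onD)
    moreover have "height z [c] = 1"
      by (simp add: z_def height_def)
    ultimately have "fst c \<in> I i"
      using nbhd_subset_root[of z r I "{i}" 0 c] by simp
    moreover have "fst c = \<alpha>"
      using lx by (simp add: xs label_def)
    ultimately show False
      using \<alpha>(3) by simp
  qed
qed

subsection \<open>Cardinalities\<close>

lemma card_of_ordLeqE:
  assumes "|A| \<le>o |B|"
  obtains f where "inj_on f A" "f ` A \<subseteq> B"
  using assms unfolding card_of_ordLeq[symmetric] by (elim exE conjE)

lemma finite_card_of_ordLeq: "finite A \<Longrightarrow> infinite B \<Longrightarrow> |A| \<le>o |B|"
  using ordLeq_total[OF card_of_Well_order[of A] card_of_Well_order[of B]] card_of_ordLeq_finite[of B A]
  by blast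

lemma card_of_Times_ordLeq:
  assumes "infinite C" "|A| \<le>o |C|" "|B| \<le>o |C|"
  shows "|A \<times> B| \<le>o |C|"
  using card_of_Times_ordLeq_infinite_Field[of "|C|" A B] assms by (simp add: Field_card_of card_of_card_order_on)

lemma card_of_lists_ordLeq:
  assumes A: "infinite A"
  shows "|lists A| \<le>o |A|"
proof -
  define L where "L n = {xs \<in> lists A. length xs = n}" for n
  have "|L n| \<le>o |A|" for n
  proof (induction n)
    case 0
    have "L 0 = {[]}"
      by (auto simp: L_def)
    then show ?case
      using A by (simp add: finite_card_of_ordLeq)
  next
    case (Suc n)
    have "L (Suc n) \<subseteq> (\<lambda>(x, xs). x # xs) ` (A \<times> L n)"
      by (auto simp: L_def length_Suc_conv)
    then have "|L (Suc n)| \<le>o |A \<times> L n|"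
      by (rule surj_imp_ordLeq)
    moreover have "|A \<times> L n| \<le>o |A|"
      using card_of_Times_ordLeq[OF A ordLeq_refl[OF card_of_Card_order] Suc] .
    ultimately show ?case
      using ordLeq_transitive by blast
  qed
  moreover have "|UNIV :: nat set| \<le>o |A|"
    using A infinite_iff_card_of_nat by blast
  ultimately have "|\<Union>n\<in>UNIV. L n| \<le>o |A|"
    by (intro card_of_UNION_ordLeq_infinite[OF A]) auto
  moreover have "lists A = (\<Union>n\<in>UNIV. L n)"
    by (auto simp: L_def)
  ultimately show ?thesis
    by simp
qed

lemma card_of_Fpow_ordLeq:
  assumes "infinite A"
  shows "|{E. finite E \<and> E \<subseteq> A}| \<le>o |A|"
proof -
  have "{E. finite E \<and> E \<subseteq> A} \<subseteq> set ` lists A"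
    by (force dest: finite_list)
  then have "|{E. finite E \<and> E \<subseteq> A}| \<le>o |lists A|"
    by (rule surj_imp_ordLeq)
  then show ?thesis
    using card_of_lists_ordLeq[OF assms] by (rule ordLeq_transitive)
qed

text \<open>Lower Dedekind cuts, coded by an enumeration of the rationals.\<close>

lemma card_of_real_ordLeq: "|UNIV :: real set| \<le>o |UNIV :: nat set set|"
proof -
  let ?f = "\<lambda>x::real. {n. real_of_rat (nat_to_rat_surj n) < x}"
  have "?f x \<noteq> ?f y" if xy: "x < y" for x y
  proof -
    obtain q where q: "x < real_of_rat q" "real_of_rat q < y"
      using of_rat_dense[OF xy] by blast
    obtain n where "q = nat_to_rat_surj n"
      using surj_nat_to_rat_surj by (metis surjD)
    then have "n \<in> ?f y - ?f x"
      using q by auto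
    then show ?thesis
      by blast
  qed
  then have "inj ?f"
    by (intro injI) (metis linorder_neqE)
  then show ?thesis
    by (rule card_of_ordLeqI) simp
qed

text \<open>Points are pairs of a list over an infinite set of size at most \<open>|Field r|\<close>
  and a real; nodes of length one give the lower bound.\<close>

lemma card_of_tree:
  assumes inf: "infinite (Field r)" and c: "|UNIV :: real set| \<le>o |Field r|"
  shows "|tree r| =o |Field r|"
proof -
  have nat: "|UNIV :: nat set| \<le>o |Field r|"
    using inf infinite_iff_card_of_nat by blast
  have "|Field r \<times> (UNIV :: nat set)| \<le>o |Field r|"
    using card_of_Times_ordLeq[OF inf ordLeq_refl[OF card_of_Card_order] nat] .
  moreover have "infinite (Field r \<times> (UNIV :: nat set))"
    using inf by (auto simp: finite_cartesian_product_iff)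
  ultimately have "|lists (Field r \<times> (UNIV :: nat set))| \<le>o |Field r|"
    using card_of_lists_ordLeq ordLeq_transitive by blast
  then have "|lists (Field r \<times> (UNIV :: nat set)) \<times> (UNIV :: real set)| \<le>o |Field r|"
    using card_of_Times_ordLeq[OF inf _ c] by blast
  moreover have "tree r \<subseteq> lists (Field r \<times> (UNIV :: nat set)) \<times> (UNIV :: real set)"
    by (auto simp: tree_def nodes_def)
  ultimately have "|tree r| \<le>o |Field r|"
    using card_of_mono1 ordLeq_transitive by blast
  moreover have "|Field r| \<le>o |tree r|"
  proof -
    have "inj_on (\<lambda>a. ([(a, 0 :: nat)], 1 :: real)) (Field r)"
      by (auto simp: inj_on_def)
    moreover have "(\<lambda>a. ([(a, 0 :: nat)], 1 :: real)) ` Field r \<subseteq> tree r"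
      by auto
    ultimately show ?thesis
      using card_of_ordLeq[of "Field r" "tree r"] by blast
  qed
  ultimately show ?thesis
    by (simp add: ordIso_iff_ordLeq)
qed

text \<open>As in Hausdorff's construction, \<open>\<xi>\<close> is tested on finitely many points and compared with a
  finite list of patterns; a point separating \<open>\<xi>\<close> from each of finitely many \<open>\<eta>\<close> gives the independence.\<close>

lemma indep_exists:
  assumes inf: "infinite S"
  obtains K :: "'a set \<Rightarrow> 'a set" where "indep S (Pow S) K"
proof -
  define C where "C = lists S \<times> (UNIV :: bool list list set)"
  have "|UNIV :: bool list list set| \<le>o |UNIV :: nat set|"
    by (rule card_of_ordLeqI[OF inj_to_nat]) simp
  then have "|UNIV :: bool list list set| \<le>o |S|"
    using inf infinite_iff_card_of_nat ordLeq_transitive by blast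
  then have "|C| \<le>o |S|"
    unfolding C_def using card_of_Times_ordLeq[OF inf card_of_lists_ordLeq[OF inf]] by blast
  then obtain g where g: "inj_on g C" "g ` C \<subseteq> S"
    by (rule card_of_ordLeqE)
  define K where "K \<xi> = g ` {(ks, ps) \<in> C. map (\<lambda>k. k \<in> \<xi>) ks \<in> set ps}" for \<xi>
  have "indep S (Pow S) K"
    unfolding indep_def
  proof (intro allI impI)
    fix E \<xi> assume E: "finite E" "E \<subseteq> Pow S" and \<xi>: "\<xi> \<in> Pow S - E"
    have "\<exists>k. k \<in> S \<and> (k \<in> \<eta> \<longleftrightarrow> k \<notin> \<xi>)" if "\<eta> \<in> E" for \<eta>
    proof -
      have "\<eta> \<noteq> \<xi>" "\<eta> \<subseteq> S" "\<xi> \<subseteq> S"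
        using that E(2) \<xi> by auto
      then show ?thesis
        by auto
    qed
    then obtain k where k: "\<And>\<eta>. \<eta> \<in> E \<Longrightarrow> k \<eta> \<in> S \<and> (k \<eta> \<in> \<eta> \<longleftrightarrow> k \<eta> \<notin> \<xi>)"
      by metis
    obtain es where es: "set es = E"
      using E(1) finite_list by blast
    \<comment> \<open>One test point is taken for each member of \<open>E\<close>, and the listed
      patterns are those of the members of \<open>E\<close>. The pattern of \<xi> differs from the
      one of \<eta> at \<open>k \<eta>\<close>.\<close>
    define ks where "ks = map k es"
    define ps where "ps = map (\<lambda>\<eta>. map (\<lambda>k. k \<in> \<eta>) ks) es"
    have C: "(ks, ps) \<in> C"
      using k es by (auto simp: C_def ks_def)
    have "g (ks, ps) \<in> K \<eta>" if "\<eta> \<in> E" for \<eta>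
      unfolding K_def using C that es by (intro imageI) (auto simp: ps_def)
    moreover have "g (ks, ps) \<notin> K \<xi>"
    proof
      assume "g (ks, ps) \<in> K \<xi>"
      then have "map (\<lambda>k. k \<in> \<xi>) ks \<in> set ps"
        using C g(1) by (auto simp: K_def dest: inj_onD)
      then obtain \<eta> where "\<eta> \<in> E" "map (\<lambda>k. k \<in> \<xi>) ks = map (\<lambda>k. k \<in> \<eta>) ks"
        using es by (auto simp: ps_def)
      then show False
        using k[of \<eta>] es by (auto simp: ks_def)
    qed
    ultimately show "\<exists>a\<in>S. a \<in> (\<Inter>\<eta>\<in>E. K \<eta>) \<and> a \<notin> K \<xi>"
      using C g(2) by blast
  qed
  then show ?thesis
    using that by blast
qed

lemma indep_comp:
  assumes K: "indep S A' K" and j: "inj_on j A" "j ` A \<subseteq> A'"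
  shows "indep S A (\<lambda>i. K (j i))"
  unfolding indep_def
proof (intro allI impI)
  fix E i assume E: "finite E" "E \<subseteq> A" "i \<in> A - E"
  have "j i \<notin> j ` E"
    using E j(1) by (auto dest: inj_onD)
  then obtain a where "a \<in> S" "a \<in> (\<Inter>x\<in>j ` E. K x)" "a \<notin> K (j i)"
    using indepD[OF K, of "j ` E" "j i"] E j(2) by blast
  then show "\<exists>a\<in>S. a \<in> (\<Inter>x\<in>E. K (j x)) \<and> a \<notin> K (j i)"
    by auto
qed

section \<open>Character of the root and weight\<close>

text \<open>Each \<open>V\<close> in the local base contains some
  \<open>nbhd r I (E V) (N V)\<close>. By independence \<open>V \<subseteq> nbhd r I {i} 0\<close>
  forces \<open>i \<in> E V\<close>, so the finite sets \<open>E V\<close> cover the infinite set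
  \<open>J\<close>.\<close>

lemma local_base_card:
  assumes ind: "indep (Field r) A I" and J: "J \<subseteq> A" "infinite J"
    and B: "\<And>U. openin (ftree r I J) U \<Longrightarrow> apex \<in> U \<Longrightarrow>
      \<exists>V\<in>B. openin (ftree r I J) V \<and> apex \<in> V \<and> V \<subseteq> U"
  shows "|J| \<le>o |B|"
proof -
  let ?B = "{V \<in> B. openin (ftree r I J) V \<and> apex \<in> V}"
  have "\<forall>V\<in>?B. \<exists>E n. finite E \<and> E \<subseteq> J \<and> nbhd r I E n \<subseteq> V"
    unfolding openin_ftree by simp
  then obtain E where "\<forall>V\<in>?B. \<exists>n. finite (E V) \<and> E V \<subseteq> J \<and> nbhd r I (E V) n \<subseteq> V"
    by (rule exE[OF bchoice])
  then obtain N where EN: "\<forall>V\<in>?B. finite (E V) \<and> E V \<subseteq> J \<and> nbhd r I (E V) (N V) \<subseteq> V"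
    by (rule exE[OF bchoice])
  note EN = bspec[OF EN]
  have sub: "J \<subseteq> (\<Union>V\<in>?B. E V)"
  proof
    fix i assume i: "i \<in> J"
    have "openin (ftree r I J) (nbhd r I {i} 0)"
      using i by (intro openin_nbhd) auto
    then obtain V where V: "V \<in> ?B" "V \<subseteq> nbhd r I {i} 0"
      using B[of "nbhd r I {i} 0"] apex_in_nbhd by blast
    have "i \<in> E V"
    proof (rule ccontr)
      assume "i \<notin> E V"
      then obtain a where a: "a \<in> Field r" "a \<in> (\<Inter>j\<in>E V. I j)" "a \<notin> I i"
        using indepD[OF ind, of "E V" i] EN[OF V(1)] J i by blast
      \<comment> \<open>Copy number \<open>N V\<close> and height 1: the branch is entire in the
        smaller neighbourhood, and the node escapes the collar of
        \<open>nbhd r I {i} 0\<close>.\<close>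
      let ?y = "([(a, N V)], 1 :: real)"
      have h: "height ?y [(a, N V)] = 1"
        by (simp add: height_def)
      then have "?y \<in> nbhd r I (E V) (N V)"
        unfolding nbhd_def using a by (intro CollectI conjI disjI2 exI[of _ "(a, N V)"]) auto
      then have "?y \<in> nbhd r I {i} 0"
        using EN[OF V(1)] V(2) by blast
      then show False
        using nbhd_subset_root[of ?y r I "{i}" 0 "(a, N V)"] h a(3) by simp
    qed
    then show "i \<in> (\<Union>V\<in>?B. E V)"
      using V by blast
  qed
  have inf: "infinite ?B"
  proof
    assume "finite ?B"
    then have "finite (\<Union>V\<in>?B. E V)"
      using EN by blast
    then show False
      using sub J(2) finite_subset by blast
  qed
  have "|\<Union>V\<in>?B. E V| \<le>o |?B|"
  proof (intro card_of_UNION_ordLeq_infinite[OF inf] ballI)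
    show "|E V| \<le>o |?B|" if "V \<in> ?B" for V
      using EN[OF that] inf by (simp add: finite_card_of_ordLeq)
  qed (rule ordLeq_refl[OF card_of_Card_order])
  moreover have "|?B| \<le>o |B|"
    by (rule card_of_mono1) blast
  ultimately show ?thesis
    by (rule ordLeq_transitive[OF card_of_mono1[OF sub] ordLeq_transitive])
qed

text \<open>The character of the root bounds the weight from below. A base of size
  \<open>|J|\<close> consists of the balls of radius 1/(n+1) with the root removed and of the sets
  \<open>nbhd r I E n\<close>.\<close>

lemma has_weight_ftree:
  assumes ind: "indep (Field r) A I" and J: "J \<subseteq> A" "infinite J"
    and tree: "|tree r| \<le>o |J|" and l: "|J| =o l"
  shows "has_weight (ftree r I J) l"
proof -
  have least: "|J| \<le>o |B|" if B: "base_of_topology (ftree r I J) B" for B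
  proof (rule local_base_card[OF ind J])
    fix U assume U: "openin (ftree r I J) U" "apex \<in> U"
    have "\<exists>C\<subseteq>B. U = \<Union>C"
      using B[unfolded base_of_topology_def, THEN conjunct2, rule_format, OF U(1)] .
    then obtain C where C: "C \<subseteq> B" "U = \<Union>C"
      by (elim exE conjE)
    then obtain V where "V \<in> C" "apex \<in> V"
      using U(2) by blast
    then show "\<exists>V\<in>B. openin (ftree r I J) V \<and> apex \<in> V \<and> V \<subseteq> U"
      using C B[unfolded base_of_topology_def, THEN conjunct1] by (intro bexI[of _ V]) auto
  qed
  define B1 where "B1 = (\<lambda>(x, n). tree.mball r x (inverse (Suc n)) - {apex}) ` (tree r \<times> UNIV)"
  define B2 where "B2 = (\<lambda>(E, n). nbhd r I E n) ` ({E. finite E \<and> E \<subseteq> J} \<times> UNIV)"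
  have nat: "|UNIV :: nat set| \<le>o |J|"
    using J(2) infinite_iff_card_of_nat by blast
  have "|B1| \<le>o |J|"
    unfolding B1_def using card_of_image card_of_Times_ordLeq[OF J(2) tree nat] ordLeq_transitive by blast
  moreover have "|B2| \<le>o |J|"
    unfolding B2_def
    using card_of_image card_of_Times_ordLeq[OF J(2) card_of_Fpow_ordLeq[OF J(2)] nat] ordLeq_transitive by blast
  ultimately have "|B1 \<union> B2| \<le>o |J|"
    using card_of_Un_ordLeq_infinite_Field[of "|J|" B1 B2] J(2) by (simp add: Field_card_of card_of_card_order_on)
  moreover have base: "base_of_topology (ftree r I J) (B1 \<union> B2)"
    unfolding base_of_topology_def
  proof (intro conjI ballI allI impI)
    fix V assume "V \<in> B1 \<union> B2"
    then show "openin (ftree r I J) V"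
    proof
      assume "V \<in> B1"
      then obtain x n where V: "V = tree.mball r x (inverse (Suc n)) - {apex}"
        by (auto simp: B1_def)
      have "openin (tree_top r) V"
        unfolding V using tree.openin_mball tree.t1_space_mtopology[of r]
        unfolding t1_space_openin_delete_alt by simp
      then show ?thesis
        using openin_ftree_off_apex[of V r I J] V by simp
    next
      assume "V \<in> B2"
      then show ?thesis
        by (auto simp: B2_def intro: openin_nbhd)
    qed
  next
    fix U assume U: "openin (ftree r I J) U"
    have "\<exists>V. V \<in> B1 \<union> B2 \<and> V \<subseteq> U \<and> x \<in> V" if x: "x \<in> U" for x
    proof (cases "x = apex")
      case True
      then obtain E n where E: "finite E" "E \<subseteq> J" "nbhd r I E n \<subseteq> U"
        using U x openin_ftree_nbhd by metis
      then have "nbhd r I E n \<in> B2"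
        by (auto simp: B2_def)
      then show ?thesis
        using E(3) True by (intro exI[of _ "nbhd r I E n"]) simp
    next
      case False
      have o: "openin (tree_top r) (U - {apex})" and xt: "x \<in> tree r"
        using U x by (auto simp: openin_ftree)
      obtain e where e: "e > 0" "tree.mball r x e \<subseteq> U - {apex}"
        using o False x unfolding tree.openin_mtopology by blast
      obtain n where n: "inverse (real (Suc n)) < e"
        using reals_Archimedean[OF e(1)] by blast
      let ?V = "tree.mball r x (inverse (Suc n)) - {apex}"
      have "?V \<in> B1"
        using xt by (auto simp: B1_def)
      moreover have "?V \<subseteq> U"
        using e(2) tree.mball_subset_concentric[of "inverse (Suc n)" e r x] n by force
      moreover have "x \<in> ?V"
        using xt False by simp
      ultimately show ?thesis
        by blast
    qed
    then show "\<exists>\<U>\<subseteq>B1 \<union> B2. U = \<Union>\<U>"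
      by (intro exI[of _ "{V \<in> B1 \<union> B2. V \<subseteq> U}"]) blast
  qed
  ultimately have "|B1 \<union> B2| =o |J|"
    using least by (simp add: ordIso_iff_ordLeq)
  then have "|B1 \<union> B2| =o l"
    using l ordIso_transitive by blast
  then show ?thesis
    unfolding has_weight_def
    using base least ordIso_ordLeq_trans[OF ordIso_symmetric[OF l]] by blast
qed

text \<open>A point \<open>x\<close> off the root has a countable local base, since it lies in an
  open metrizable subspace. If \<open>h\<close> sent \<open>x\<close> to the root, the image base
  would contradict \<open>local_base_card\<close> for the uncountable \<open>J'\<close>.\<close>

lemma homeomorphic_map_fixes_apex:
  assumes ind: "indep (Field r) A I" and J': "J' \<subseteq> A" "uncountable J'"
    and h: "homeomorphic_map (ftree r I J) (ftree r I J') h"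
  shows "h apex = apex"
proof (rule ccontr)
  assume ne: "h apex \<noteq> apex"
  have "h ` tree r = tree r"
    using homeomorphic_imp_surjective_map[OF h] by simp
  then obtain x where x: "x \<in> tree r" "h x = apex"
    using apex_in_tree by (metis imageE)
  let ?Y = "tree r - {apex}"
  have xY: "x \<in> ?Y"
    using x ne by auto
  have oY: "openin (ftree r I J) ?Y"
    using openin_ftree_off_apex openin_tree_minus_apex by blast
  have "first_countable (subtopology (ftree r I J) ?Y)"
    using metrizable_imp_first_countable[OF metrizable_ftree_off_apex[of r I J]] by simp
  then obtain B where B: "countable B" "\<And>V. V \<in> B \<Longrightarrow> openin (subtopology (ftree r I J) ?Y) V"
      "\<And>U. openin (subtopology (ftree r I J) ?Y) U \<Longrightarrow> x \<in> U \<Longrightarrow> \<exists>V\<in>B. x \<in> V \<and> V \<subseteq> U"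
    using xY unfolding first_countable_def by (metis topspace_ftree topspace_subtopology_subset Diff_subset)
  have "|J'| \<le>o |(`) h ` B|"
  proof (rule local_base_card[OF ind J'(1)])
    show "infinite J'"
      using J'(2) countable_finite by blast
    fix U assume U: "openin (ftree r I J') U" "apex \<in> U"
    let ?U = "{z \<in> topspace (ftree r I J). h z \<in> U} \<inter> ?Y"
    have "openin (ftree r I J) ?U"
      using openin_continuous_map_preimage[OF homeomorphic_imp_continuous_map[OF h] U(1)] oY by blast
    then have "openin (subtopology (ftree r I J) ?Y) ?U"
      using openin_open_subtopology[OF oY] by blast
    moreover have "x \<in> ?U"
      using x xY U(2) by simp
    ultimately obtain V where V: "V \<in> B" "x \<in> V" "V \<subseteq> ?U"
      using B(3) by blast
    have "openin (ftree r I J) V"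
      using B(2)[OF V(1)] openin_open_subtopology[OF oY] by blast
    then have "openin (ftree r I J') (h ` V)"
      using homeomorphic_imp_open_map[OF h] by (simp add: open_map_def)
    moreover have "apex \<in> h ` V"
      using V(2) x(2) by (metis imageI)
    ultimately show "\<exists>W\<in>(`) h ` B. openin (ftree r I J') W \<and> apex \<in> W \<and> W \<subseteq> U"
      using V by (intro bexI[of _ "h ` V"]) auto
  qed
  then obtain f where f: "inj_on f J'" "f ` J' \<subseteq> (`) h ` B"
    by (rule card_of_ordLeqE)
  then have "countable (f ` J')"
    using countable_subset[OF f(2) countable_image[OF B(1)]] by simp
  then show False
    using countable_image_inj_on[OF _ f(1)] J'(2) by simp
qed

lemma homeomorphic_ftree_index:
  assumes wo: "Well_order r" and ind: "indep (Field r) A I"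
    and J: "J \<subseteq> A" "uncountable J" and J': "J' \<subseteq> A" "uncountable J'"
    and hom: "ftree r I J homeomorphic_space ftree r I J'"
  shows "J = J'"
proof -
  have "J \<subseteq> J'" if hom: "ftree r I J homeomorphic_space ftree r I J'"
    and J: "J \<subseteq> A" "J' \<subseteq> A" "uncountable J'" for J J'
  proof -
    obtain h where h: "homeomorphic_map (ftree r I J) (ftree r I J') h"
      using hom homeomorphic_space[of "ftree r I J" "ftree r I J'"] by blast
    show ?thesis
      using homeomorphic_map_index_subset[OF wo ind J(1,2) h homeomorphic_map_fixes_apex[OF ind J(2,3) h]] .
  qed
  then show ?thesis
    using assms homeomorphic_space_sym[of "ftree r I J" "ftree r I J'"] by (intro subset_antisym) blast+
qed

section \<open>Transport to the carrier \<open>Field \<kappa>\<close> and the count of the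
  spaces\<close>

lemma homeomorphic_map_pullback_topology:
  assumes "bij_betw b A (topspace X)"
  shows "homeomorphic_map (pullback_topology A b X) X b"
proof -
  have top: "topspace (pullback_topology A b X) = A"
    using assms by (auto simp: topspace_pullback_topology bij_betw_def)
  have "continuous_map (pullback_topology A b X) X b"
    using continuous_map_pullback[OF continuous_map_id, of A b X] by simp
  moreover have "open_map (pullback_topology A b X) X b"
    unfolding open_map_def
  proof (intro allI impI)
    fix V assume "openin (pullback_topology A b X) V"
    then obtain U where U: "openin X U" "V = b -` U \<inter> A"
      by (auto simp: openin_pullback_topology)
    have "U \<subseteq> b ` A"
      using assms openin_subset[OF U(1)] by (simp add: bij_betw_def)
    then have "b ` V = U"
      using U(2) by blast
    then show "openin X (b ` V)"
      using U by simp
  qed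
  ultimately show ?thesis
    using assms top by (intro bijective_open_imp_homeomorphic_map) (auto simp: bij_betw_def)
qed

theorem theorem2:
  fixes \<kappa> :: "'k rel" and lam :: "'l rel"
  assumes "Cinfinite \<kappa>" and "Cinfinite lam"
    and "ctwo ^c natLeq \<le>o \<kappa>" and "\<kappa> \<le>o lam" and "lam \<le>o ctwo ^c \<kappa>"
  shows "\<exists>\<X> :: 'k topology set.
    |\<X>| =o ctwo ^c lam \<and>
    (\<forall>X\<in>\<X>. path_connected_space X \<and> locally_path_connected_space X \<and>
       almost_metrizable_space X \<and> |topspace X| =o \<kappa> \<and> has_weight X lam) \<and>
    (\<forall>X\<in>\<X>. \<forall>Y\<in>\<X>. X \<noteq> Y \<longrightarrow> \<not> X homeomorphic_space Y)"
proof -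
  have infk: "infinite (Field \<kappa>)" and infl: "infinite (Field lam)"
    using assms(1,2) by (auto simp: cinfinite_def)
  have fk: "|Field \<kappa>| =o \<kappa>" and fl: "|Field lam| =o lam"
    using assms(1,2) card_of_Field_ordIso by auto
  have wo: "Well_order \<kappa>"
    using assms(1) card_order_on_well_order_on by blast
  have pow: "|Pow S| =o ctwo ^c r" if "|S| =o r" for S :: "'z set" and r :: "'y rel"
  proof -
    have "|Pow S| =o ctwo ^c |S|"
      using card_of_Pow_Func[of S] by (simp add: cexp_def ctwo_def Field_card_of)
    then show ?thesis
      using cexp_cong2[OF that Card_order_ctwo card_of_Card_order] by (rule ordIso_transitive)
  qed
  have "|UNIV :: nat set set| =o ctwo ^c natLeq"
    using pow[OF card_of_nat] by simp
  then have "|UNIV :: nat set set| \<le>o |Field \<kappa>|"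
    using assms(3) fk by (meson ordIso_ordLeq_trans ordIso_symmetric ordLeq_ordIso_trans)
  then have realk: "|UNIV :: real set| \<le>o |Field \<kappa>|"
    using card_of_real_ordLeq ordLeq_transitive by blast
  have tk: "|tree \<kappa>| =o |Field \<kappa>|"
    using card_of_tree[OF infk realk] .
  have kl: "|Field \<kappa>| \<le>o |Field lam|"
    using assms(4) fk fl by (meson ordIso_ordLeq_trans ordIso_symmetric ordLeq_ordIso_trans)
  define A where "A = Field lam \<times> (UNIV :: bool set)"
  have "|UNIV :: bool set| \<le>o |Field lam|"
    using infl by (simp add: finite_card_of_ordLeq)
  then have Al: "|A| \<le>o |Field lam|"
    unfolding A_def using card_of_Times_ordLeq[OF infl ordLeq_refl[OF card_of_Card_order]] by blast
  \<comment> \<open>The bound \<open>lam \<le>o ctwo ^c \<kappa>\<close> enters here: it lets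
    \<open>A\<close> index part of an independent family of subsets of
    \<open>Field \<kappa>\<close>.\<close>
  have "|Field lam| \<le>o |Pow (Field \<kappa>)|"
    using assms(1,5) fl pow[OF fk] by (meson ordIso_ordLeq_trans ordIso_symmetric ordLeq_ordIso_trans)
  then have "|A| \<le>o |Pow (Field \<kappa>)|"
    using Al ordLeq_transitive by blast
  then obtain j where j: "inj_on j A" "j ` A \<subseteq> Pow (Field \<kappa>)"
    by (rule card_of_ordLeqE)
  obtain K where "indep (Field \<kappa>) (Pow (Field \<kappa>)) K"
    using indep_exists[OF infk] by blast
  define I where "I i = K (j i)" for i
  have ind: "indep (Field \<kappa>) A I"
    unfolding I_def using indep_comp[OF \<open>indep (Field \<kappa>) (Pow (Field \<kappa>)) K\<close> j] .
  \<comment> \<open>The constant half keeps the size of \<open>J B\<close> equal to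
    \<open>lam\<close> even for small \<open>B\<close>; the other half codes
    \<open>B\<close>.\<close>
  define J where "J B = Field lam \<times> {False} \<union> B \<times> {True}" for B
  have JA: "J B \<subseteq> A" if "B \<subseteq> Field lam" for B
    using that by (auto simp: J_def A_def)
  have Jl: "|J B| =o |Field lam|" if "B \<subseteq> Field lam" for B
  proof -
    have "|Field lam \<times> {False}| \<le>o |J B|"
      by (rule card_of_mono1) (simp add: J_def)
    then have "|Field lam| \<le>o |J B|"
      using card_of_Times1[of "{False}" "Field lam"] ordLeq_transitive by blast
    moreover have "|J B| \<le>o |Field lam|"
      using card_of_mono1[OF JA[OF that]] Al ordLeq_transitive by blast
    ultimately show ?thesis
      by (simp add: ordIso_iff_ordLeq)
  qed
  have Junc: "uncountable (J B)" if "B \<subseteq> Field lam" for B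
  proof
    assume c: "countable (J B)"
    have "|UNIV :: real set| \<le>o |J B|"
      using realk kl Jl[OF that] by (meson ordIso_symmetric ordLeq_ordIso_trans ordLeq_transitive)
    then obtain f where "inj_on f (UNIV :: real set)" "f ` UNIV \<subseteq> J B"
      by (rule card_of_ordLeqE)
    then have "countable (UNIV :: real set)"
      using c countable_subset countable_image_inj_on by blast
    then show False
      using uncountable_UNIV_real by blast
  qed
  obtain b where b: "bij_betw b (Field \<kappa>) (tree \<kappa>)"
    using tk card_of_ordIso ordIso_symmetric by blast
  \<comment> \<open>The tree has size \<kappa>, so its topologies can be carried over to
    \<open>Field \<kappa>\<close>, as the type \<open>'k topology\<close> demands.\<close>
  define X where "X B = pullback_topology (Field \<kappa>) b (ftree \<kappa> I (J B))" for B
  have hm: "homeomorphic_map (X B) (ftree \<kappa> I (J B)) b" for B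
    unfolding X_def by (rule homeomorphic_map_pullback_topology) (simp add: b)
  have hs: "X B homeomorphic_space ftree \<kappa> I (J B)" for B
    using homeomorphic_map_imp_homeomorphic_space[OF hm] .
  have BB: "B = B'" if "B \<subseteq> Field lam" "B' \<subseteq> Field lam" "X B homeomorphic_space X B'" for B B'
  proof -
    have "ftree \<kappa> I (J B) homeomorphic_space ftree \<kappa> I (J B')"
      using that(3) hs homeomorphic_space_sym homeomorphic_space_trans by metis
    then have "J B = J B'"
      using homeomorphic_ftree_index[OF wo ind] JA Junc that by blast
    then show ?thesis
      by (auto simp: J_def)
  qed
  have props: "path_connected_space (X B) \<and> locally_path_connected_space (X B) \<and>
       almost_metrizable_space (X B) \<and> |topspace (X B)| =o \<kappa> \<and> has_weight (X B) lam"
    if B: "B \<subseteq> Field lam" for B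
  proof (intro conjI)
    have hs': "ftree \<kappa> I (J B) homeomorphic_space X B"
      using hs homeomorphic_space_sym by blast
    show "path_connected_space (X B)"
      using homeomorphic_path_connected_space[OF hs] path_connected_ftree by blast
    show "locally_path_connected_space (X B)"
      using homeomorphic_locally_path_connected_space[OF hs] locally_path_connected_ftree by blast
    show "almost_metrizable_space (X B)"
      using homeomorphic_almost_metrizable_space[OF hs' almost_metrizable_ftree] .
    have "topspace (X B) = Field \<kappa>"
      using b by (auto simp: X_def topspace_pullback_topology bij_betw_def)
    then show "|topspace (X B)| =o \<kappa>"
      using fk by simp
    have "|tree \<kappa>| \<le>o |J B|"
      using tk kl Jl[OF B] by (meson ordIso_ordLeq_trans ordIso_symmetric ordLeq_ordIso_trans)
    moreover have "infinite (J B)"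
      using Junc[OF B] countable_finite by blast
    moreover have "|J B| =o lam"
      using Jl[OF B] fl ordIso_transitive by blast
    ultimately show "has_weight (X B) lam"
      using has_weight_ftree[OF ind JA[OF B]] homeomorphic_has_weight[OF hs'] by blast
  qed
  show ?thesis
  proof (intro exI conjI)
    \<comment> \<open>Equal spaces are homeomorphic, so \<open>BB\<close> yields injectivity in
      addition to pairwise non-homeomorphism.\<close>
    have "inj_on X (Pow (Field lam))"
      using BB by (intro inj_onI) (metis PowD homeomorphic_space_refl)
    then have "|X ` Pow (Field lam)| =o |Pow (Field lam)|"
      using card_of_ordIso bij_betw_imageI ordIso_symmetric by blast
    then show "|X ` Pow (Field lam)| =o ctwo ^c lam"
      using pow[OF fl] ordIso_transitive by blast
  qed (use props BB in blast)+
qed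

end
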